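(* Let $F$ be a field and let $X$ be a finite category with a terminal object $t$. Let $R\in\mathrm{rep}(X,\mathbf{vect}_F)$ be an indecomposable linear representation of $X$. If $R$ is additively $\mathbf{Set}$-realizable, then $R(t)$ is at most one-dimensional.
   Context: For a small category $X$ and a category $C$, $\mathrm{rep}(X,C)$ is the category of functors $X\to C$. $\mathbf{Vect}_F$ (resp. $\mathbf{vect}_F$) is the category of (finite-dimensional) $F$-vector spaces. $\mathtt{free}\colon\mathbf{Set}\to\mathbf{Vect}_F$ sends a set to the free vector space on it, and $\mathtt{free}_*(S)=\mathtt{free}\circ S$ for $S\in\mathrm{rep}(X,\mathbf{Set})$. A representation in $\mathrm{rep}(X,\mathbf{Vect}_F)$ is additively $\mathbf{Set}$-realizable if it lies in the additive image of $\mathtt{free}_*\colon\mathrm{rep}(X,\mathbf{Set})\to\mathrm{rep}(X,\mathbf{Vect}_F)$, i.e. if it is a finite direct sum of direct summands of representations isomorphic to some $\mathtt{free}\circ S$. *)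

theory Defs
  imports "Jordan_Normal_Form.Missing_VectorSpace"
begin

section \<open>Small categories\<close>

record ('o, 'm) cat =
  Obj :: "'o set"
  Mor :: "'m set"
  Src :: "'m \<Rightarrow> 'o"
  Tgt :: "'m \<Rightarrow> 'o"
  Idn :: "'o \<Rightarrow> 'm"
  Cmp :: "'m \<Rightarrow> 'm \<Rightarrow> 'm"  \<comment> \<open>\<open>Cmp X g f\<close> is \<open>g\<close> after \<open>f\<close>\<close>

locale category =
  fixes X :: "('o, 'm) cat"
  assumes Src_in: "f \<in> Mor X \<Longrightarrow> Src X f \<in> Obj X"
    and Tgt_in: "f \<in> Mor X \<Longrightarrow> Tgt X f \<in> Obj X"
    and Idn_in: "a \<in> Obj X \<Longrightarrow> Idn X a \<in> Mor X"
    and Src_Idn: "a \<in> Obj X \<Longrightarrow> Src X (Idn X a) = a"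
    and Tgt_Idn: "a \<in> Obj X \<Longrightarrow> Tgt X (Idn X a) = a"
    and Cmp_in: "\<lbrakk>f \<in> Mor X; g \<in> Mor X; Tgt X f = Src X g\<rbrakk> \<Longrightarrow> Cmp X g f \<in> Mor X"
    and Src_Cmp: "\<lbrakk>f \<in> Mor X; g \<in> Mor X; Tgt X f = Src X g\<rbrakk> \<Longrightarrow> Src X (Cmp X g f) = Src X f"
    and Tgt_Cmp: "\<lbrakk>f \<in> Mor X; g \<in> Mor X; Tgt X f = Src X g\<rbrakk> \<Longrightarrow> Tgt X (Cmp X g f) = Tgt X g"
    and Cmp_Idn_right: "f \<in> Mor X \<Longrightarrow> Cmp X f (Idn X (Src X f)) = f"
    and Cmp_Idn_left: "f \<in> Mor X \<Longrightarrow> Cmp X (Idn X (Tgt X f)) f = f"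
    and Cmp_assoc: "\<lbrakk>f \<in> Mor X; g \<in> Mor X; h \<in> Mor X; Tgt X f = Src X g; Tgt X g = Src X h\<rbrakk>
      \<Longrightarrow> Cmp X h (Cmp X g f) = Cmp X (Cmp X h g) f"

locale finite_category = category +
  assumes finite_Obj: "finite (Obj X)"
    and finite_Mor: "finite (Mor X)"

definition terminal_object :: "('o, 'm) cat \<Rightarrow> 'o \<Rightarrow> bool" where
  "terminal_object X t \<longleftrightarrow>
    t \<in> Obj X \<and> (\<forall>a\<in>Obj X. \<exists>!f. f \<in> Mor X \<and> Src X f = a \<and> Tgt X f = t)"


section \<open>Representations in sets and in vector spaces\<close>

text \<open>A functor into sets or vector spaces: \<open>ob\<close> gives the set or space at an object, \<open>ar\<close> the
  map of a morphism. Maps are total functions of which only the values on the carrier of the source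
  are meaningful, so equations between maps are required on carriers only.\<close>

record ('o, 'm, 'c, 'e) rep =
  ob :: "'o \<Rightarrow> 'c"
  ar :: "'m \<Rightarrow> 'e \<Rightarrow> 'e"

type_synonym ('o, 'm, 's) set_rep = "('o, 'm, 's set, 's) rep"
type_synonym ('o, 'm, 'k, 'v) vect_rep = "('o, 'm, ('k, 'v) module, 'v) rep"

locale set_rep = category X for X :: "('o, 'm) cat" +
  fixes S :: "('o, 'm, 's) set_rep"
  assumes ar_in: "f \<in> Mor X \<Longrightarrow> ar S f \<in> ob S (Src X f) \<rightarrow> ob S (Tgt X f)"
    and ar_Idn: "\<lbrakk>a \<in> Obj X; x \<in> ob S a\<rbrakk> \<Longrightarrow> ar S (Idn X a) x = x"
    and ar_Cmp: "\<lbrakk>f \<in> Mor X; g \<in> Mor X; Tgt X f = Src X g; x \<in> ob S (Src X f)\<rbrakk>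
      \<Longrightarrow> ar S (Cmp X g f) x = ar S g (ar S f x)"

locale vect_rep = category X + field K
  for K :: "('k, 'r) ring_scheme" and X :: "('o, 'm) cat" +
  fixes R :: "('o, 'm, 'k, 'v) vect_rep"
  assumes ob_vectorspace: "a \<in> Obj X \<Longrightarrow> vectorspace K (ob R a)"
    and ar_linear: "f \<in> Mor X \<Longrightarrow> linear_map K (ob R (Src X f)) (ob R (Tgt X f)) (ar R f)"
    and ar_Idn: "\<lbrakk>a \<in> Obj X; v \<in> carrier (ob R a)\<rbrakk> \<Longrightarrow> ar R (Idn X a) v = v"
    and ar_Cmp: "\<lbrakk>f \<in> Mor X; g \<in> Mor X; Tgt X f = Src X g; v \<in> carrier (ob R (Src X f))\<rbrakk>
      \<Longrightarrow> ar R (Cmp X g f) v = ar R g (ar R f v)"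

locale fin_dim_vect_rep = vect_rep +
  assumes fin_dim: "a \<in> Obj X \<Longrightarrow> vectorspace.fin_dim K (ob R a)"

definition rep_isomorphic ::
  "('k, 'r) ring_scheme \<Rightarrow> ('o, 'm) cat \<Rightarrow> ('o, 'm, 'k, 'v) vect_rep \<Rightarrow> ('o, 'm, 'k, 'w) vect_rep \<Rightarrow> bool"
  where "rep_isomorphic K X R Q \<longleftrightarrow> (\<exists>\<eta>.
    (\<forall>a\<in>Obj X. linear_map K (ob R a) (ob Q a) (\<eta> a) \<and>
       bij_betw (\<eta> a) (carrier (ob R a)) (carrier (ob Q a))) \<and>
    (\<forall>f\<in>Mor X. \<forall>v\<in>carrier (ob R (Src X f)).
       \<eta> (Tgt X f) (ar R f v) = ar Q f (\<eta> (Src X f) v)))"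


section \<open>Free representations\<close>

text \<open>The free vector space on a set \<open>A\<close>: finitely supported functions from \<open>A\<close> to \<open>K\<close>
  (the set \<open>A\<close> may be infinite).\<close>

definition free_space :: "('k, 'r) ring_scheme \<Rightarrow> 's set \<Rightarrow> ('k, 's \<Rightarrow> 'k) module" where
  "free_space K A = (ring.func_space K A)
     \<lparr>carrier := {c \<in> A \<rightarrow>\<^sub>E carrier K. finite {x \<in> A. c x \<noteq> \<zero>\<^bsub>K\<^esub>}}\<rparr>"

text \<open>The linear extension of \<open>\<phi> : A \<rightarrow> B\<close>, sending the basis vector of \<open>x\<close> to that of \<open>\<phi> x\<close>.
  The sum runs over the support of \<open>c\<close> because \<open>finsum\<close> needs a finite index set.\<close>

definition free_map :: "('k, 'r) ring_scheme \<Rightarrow> 's set \<Rightarrow> 's set \<Rightarrow> ('s \<Rightarrow> 's) \<Rightarrow> ('s \<Rightarrow> 'k) \<Rightarrow> ('s \<Rightarrow> 'k)" where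
  "free_map K A B \<phi> c = restrict (\<lambda>y. \<Oplus>\<^bsub>K\<^esub>x\<in>{x \<in> A. c x \<noteq> \<zero>\<^bsub>K\<^esub> \<and> \<phi> x = y}. c x) B"

definition free_rep ::
  "('k, 'r) ring_scheme \<Rightarrow> ('o, 'm) cat \<Rightarrow> ('o, 'm, 's) set_rep \<Rightarrow> ('o, 'm, 'k, 's \<Rightarrow> 'k) vect_rep" where
  "free_rep K X S =
    \<lparr>ob = (\<lambda>a. free_space K (ob S a)),
     ar = (\<lambda>f. free_map K (ob S (Src X f)) (ob S (Tgt X f)) (ar S f))\<rparr>"


section \<open>Direct sums, summands and indecomposability\<close>

definition subrep ::
  "('k, 'r) ring_scheme \<Rightarrow> ('o, 'm) cat \<Rightarrow> ('o, 'm, 'k, 'v) vect_rep \<Rightarrow> ('o \<Rightarrow> 'v set) \<Rightarrow> bool" where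
  "subrep K X R U \<longleftrightarrow>
    (\<forall>a\<in>Obj X. subspace K (U a) (ob R a)) \<and>
    (\<forall>f\<in>Mor X. ar R f \<in> U (Src X f) \<rightarrow> U (Tgt X f))"

definition rep_restrict :: "('o, 'm, 'k, 'v) vect_rep \<Rightarrow> ('o \<Rightarrow> 'v set) \<Rightarrow> ('o, 'm, 'k, 'v) vect_rep" where
  "rep_restrict R U = \<lparr>ob = (\<lambda>a. (ob R a)\<lparr>carrier := U a\<rparr>), ar = ar R\<rparr>"

definition zero_rep :: "('o, 'm) cat \<Rightarrow> ('o, 'm, 'k, 'v) vect_rep \<Rightarrow> bool" where
  "zero_rep X R \<longleftrightarrow> (\<forall>a\<in>Obj X. carrier (ob R a) = {\<zero>\<^bsub>ob R a\<^esub>})"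

text \<open>Direct sums are internal. Every decomposition of \<open>R\<close> up to isomorphism is
  isomorphic to an internal one, by transport along the isomorphism.\<close>

definition direct_sum2 ::
  "('k, 'r) ring_scheme \<Rightarrow> ('o, 'm) cat \<Rightarrow> ('o, 'm, 'k, 'v) vect_rep
    \<Rightarrow> ('o \<Rightarrow> 'v set) \<Rightarrow> ('o \<Rightarrow> 'v set) \<Rightarrow> bool" where
  "direct_sum2 K X R U W \<longleftrightarrow> subrep K X R U \<and> subrep K X R W \<and>
    (\<forall>a\<in>Obj X. U a \<inter> W a = {\<zero>\<^bsub>ob R a\<^esub>} \<and> module.submodule_sum (ob R a) (U a) (W a) = carrier (ob R a))"

definition direct_sum_decomp ::
  "('k, 'r) ring_scheme \<Rightarrow> ('o, 'm) cat \<Rightarrow> ('o, 'm, 'k, 'v) vect_rep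
    \<Rightarrow> nat \<Rightarrow> (nat \<Rightarrow> 'o \<Rightarrow> 'v set) \<Rightarrow> bool" where
  "direct_sum_decomp K X R n U \<longleftrightarrow> (\<forall>i<n. subrep K X R (U i)) \<and>
    (\<forall>a\<in>Obj X. \<forall>v\<in>carrier (ob R a).
      \<exists>!u. u \<in> (\<Pi>\<^sub>E i\<in>{..<n}. U i a) \<and> v = (\<Oplus>\<^bsub>ob R a\<^esub>i\<in>{..<n}. u i))"

definition direct_summand ::
  "('k, 'r) ring_scheme \<Rightarrow> ('o, 'm) cat \<Rightarrow> ('o, 'm, 'k, 'v) vect_rep \<Rightarrow> ('o \<Rightarrow> 'v set) \<Rightarrow> bool" where
  "direct_summand K X R U \<longleftrightarrow> (\<exists>W. direct_sum2 K X R U W)"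

definition indecomposable ::
  "('k, 'r) ring_scheme \<Rightarrow> ('o, 'm) cat \<Rightarrow> ('o, 'm, 'k, 'v) vect_rep \<Rightarrow> bool" where
  "indecomposable K X R \<longleftrightarrow> \<not> zero_rep X R \<and>
    (\<forall>U W. direct_sum2 K X R U W \<longrightarrow>
      zero_rep X (rep_restrict R U) \<or> zero_rep X (rep_restrict R W))"

text \<open>\<open>R\<close> is a finite direct sum of representations, each isomorphic to a direct summand of the free
  representation on some set-valued representation. The type argument is the universe from which
  the sets are drawn; HOL cannot quantify over it inside a formula. A theorem that assumes this
  predicate with a free type variable covers sets in every universe. One universe suffices
  for the finitely many summands, as finitely many types embed in one.\<close>

definition additively_Set_realizable ::
  "'s itself \<Rightarrow> ('k, 'r) ring_scheme \<Rightarrow> ('o, 'm) cat \<Rightarrow> ('o, 'm, 'k, 'v) vect_rep \<Rightarrow> bool" where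
  "additively_Set_realizable (_ :: 's itself) K X R \<longleftrightarrow>
    (\<exists>n U. direct_sum_decomp K X R n U \<and>
      (\<forall>i<n. \<exists>(S :: ('o, 'm, 's) set_rep) P.
        set_rep X S \<and> direct_summand K X (free_rep K X S) P \<and>
        rep_isomorphic K X (rep_restrict R (U i)) (rep_restrict (free_rep K X S) P)))"

end

theory Submission
  imports Defs
begin

text \<open>A set-valued functor \<open>S\<close> is the disjoint union of its fibres over the elements \<open>s\<close> of \<open>S(t)\<close>, so
  cutting down to the fibre over \<open>s\<close> is a natural idempotent of the free representation that has
  rank at most one at \<open>t\<close>. Conjugating these idempotents by the inclusions and projections that
  realize \<open>R\<close> gives endomorphisms of \<open>R\<close> of rank at most one at \<open>t\<close>, and no nonzero vector of \<open>R(t)\<close>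
  is killed by all of them. Since \<open>R(t)\<close> is finite-dimensional, one can go around a cycle of such
  endomorphisms: some composite has rank one at \<open>t\<close> and is not nilpotent there. By Fitting's lemma
  an endomorphism of an indecomposable representation that is not nilpotent at \<open>t\<close> is injective,
  so \<open>R(t)\<close> has dimension one.\<close>

section \<open>Linear algebra\<close>

lemma linear_mapI:
  assumes "vectorspace K V" "vectorspace K W"
    and "\<And>v. v \<in> carrier V \<Longrightarrow> T v \<in> carrier W"
    and "\<And>v w. \<lbrakk>v \<in> carrier V; w \<in> carrier V\<rbrakk> \<Longrightarrow> T (v \<oplus>\<^bsub>V\<^esub> w) = T v \<oplus>\<^bsub>W\<^esub> T w"
    and "\<And>c v. \<lbrakk>c \<in> carrier K; v \<in> carrier V\<rbrakk> \<Longrightarrow> T (c \<odot>\<^bsub>V\<^esub> v) = c \<odot>\<^bsub>W\<^esub> T v"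
  shows "linear_map K V W T"
proof -
  interpret V: vectorspace K V by fact
  interpret W: vectorspace K W by fact
  show ?thesis
    using assms(3-5) by unfold_locales (auto simp: module_hom_def)
qed

lemma linear_mapD:
  assumes "linear_map K V W T"
  shows "vectorspace K V" "vectorspace K W"
    and "\<And>v. v \<in> carrier V \<Longrightarrow> T v \<in> carrier W"
    and "\<And>v w. \<lbrakk>v \<in> carrier V; w \<in> carrier V\<rbrakk> \<Longrightarrow> T (v \<oplus>\<^bsub>V\<^esub> w) = T v \<oplus>\<^bsub>W\<^esub> T w"
    and "\<And>c v. \<lbrakk>c \<in> carrier K; v \<in> carrier V\<rbrakk> \<Longrightarrow> T (c \<odot>\<^bsub>V\<^esub> v) = c \<odot>\<^bsub>W\<^esub> T v"
    and "T \<zero>\<^bsub>V\<^esub> = \<zero>\<^bsub>W\<^esub>"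
  using assms mod_hom.f0_is_0[of K V W T] mod_hom.f_hom[of K V W T]
  unfolding linear_map_def module_hom_def by auto

lemma linear_map_comp:
  assumes "linear_map K U V S" "linear_map K V W T"
  shows "linear_map K U W (\<lambda>x. T (S x))"
  by (rule linear_mapI) (simp_all add: linear_mapD[OF assms(1)] linear_mapD[OF assms(2)])

lemma (in vectorspace) linear_map_id: "linear_map K V V (\<lambda>x. x)"
  by (rule linear_mapI) (auto intro: vectorspace_axioms)

lemma (in vectorspace) linear_map_funpow:
  assumes "linear_map K V V f"
  shows "linear_map K V V (f ^^ n)"
proof (induction n)
  case 0
  show ?case using linear_map_id by (simp add: id_def)
next
  case (Suc n)
  show ?case using linear_map_comp[OF Suc assms] by (simp add: comp_def)
qed

lemma subspaceD:
  assumes "subspace K U V"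
  shows "U \<subseteq> carrier V" "\<zero>\<^bsub>V\<^esub> \<in> U"
    and "\<And>v w. \<lbrakk>v \<in> U; w \<in> U\<rbrakk> \<Longrightarrow> v \<oplus>\<^bsub>V\<^esub> w \<in> U"
    and "\<And>c v. \<lbrakk>c \<in> carrier K; v \<in> U\<rbrakk> \<Longrightarrow> c \<odot>\<^bsub>V\<^esub> v \<in> U"
    and "vectorspace K V" "submodule K U V"
  using assms unfolding subspace_def LinearCombinations.submodule_def by auto

lemma (in linear_map) subspace_kernel: "subspace K {v \<in> carrier V. T v = \<zero>\<^bsub>W\<^esub>} V"
  using kerT_is_subspace unfolding ker_def by simp

lemma (in linear_map) subspace_image: "subspace K (T ` carrier V) W"
  using imT_is_subspace unfolding im_def by simp

text \<open>The maximal size of an independent subset serves as the dimension of a subspace; this avoids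
  changing to the subspace as ambient space.\<close>

lemma (in vectorspace) obtains_subspace_rank:
  assumes fin_dim
  obtains d :: "'c set \<Rightarrow> nat"
  where "\<And>U. d U \<le> dim"
    and "\<And>U W. \<lbrakk>subspace K U V; subspace K W V; U \<subset> W\<rbrakk> \<Longrightarrow> d U < d W"
proof -
  \<comment> \<open>Intersecting with the carrier lets the bound by \<open>dim\<close> hold for
    every set \<open>U\<close>, not only for subspaces.\<close>
  define I where "I U = {B. B \<subseteq> U \<inter> carrier V \<and> lin_indpt B}" for U
  define d where "d U = Max (card ` I U)" for U
  have le: "card B \<le> dim" if "B \<in> I U" for B U
    using that li_le_dim[OF assms] unfolding I_def by auto
  have fin: "finite (card ` I U)" for U
    by (rule finite_subset[of _ "{..dim}"]) (use le in auto)
  \<comment> \<open>\<open>Max\<close> is meaningful only on a nonempty set; the empty independent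
    set ensures this for every \<open>U\<close>.\<close>
  have "{} \<in> I U" for U
    unfolding I_def using finite_lin_indpt2[of "{}"] by auto
  then have ne: "card ` I U \<noteq> {}" for U
    by auto
  show thesis
  proof
    show "d U \<le> dim" for U
      unfolding d_def using fin ne le by (subst Max_le_iff) auto
    fix U W assume U: "subspace K U V" and W: "subspace K W V" and UW: "U \<subset> W"
    obtain B where B: "B \<in> I U" "card B = d U"
      using Max_in[OF fin ne, of U] unfolding d_def by auto
    have BU: "B \<subseteq> U" "B \<subseteq> carrier V" "lin_indpt B"
      using B(1) unfolding I_def by auto
    obtain w where w: "w \<in> W" "w \<notin> U"
      using UW by auto
    \<comment> \<open>The span of \<open>B\<close> cannot leave \<open>U\<close>, so
      \<open>B\<close> stays independent when a vector \<open>w\<close> outside \<open>U\<close> is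
      added.\<close>
    have "span B \<subseteq> U"
      using span_is_subset[of B U] BU(1) subspaceD(6)[OF U] by auto
    then have nin: "w \<notin> span B" "w \<notin> B"
      using w BU by auto
    have wV: "w \<in> carrier V"
      using w subspaceD(1)[OF W] by auto
    have "lin_indpt (B \<union> {w})"
      using lin_dep_iff_in_span[OF BU(2,3) wV nin(2)] nin by auto
    then have "insert w B \<in> I W"
      unfolding I_def using BU w wV UW by auto
    then have "card (insert w B) \<le> d W"
      unfolding d_def using fin by auto
    moreover have "finite B"
      using li_le_dim[OF assms BU(2,3)] by auto
    ultimately show "d U < d W"
      using nin B by auto
  qed
qed

section \<open>Endomorphisms of a finite-dimensional space\<close>

text \<open>The kernels of the powers of \<open>f\<close> ascend and their images descend, so
  bounded rank makes both chains stop. \<open>U\<close> and \<open>W\<close> are stated without the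
  exponents at which this happens, since these may vary with the object once \<open>f\<close> is a
  component of an endomorphism of a representation.\<close>

lemma (in vectorspace) fitting_decomposition:
  assumes fd: fin_dim and f: "linear_map K V V f"
  defines "U \<equiv> {v \<in> carrier V. \<exists>n. (f ^^ n) v = \<zero>\<^bsub>V\<^esub>}"
    and "W \<equiv> (\<Inter>n. (f ^^ n) ` carrier V)"
  shows "subspace K U V" "subspace K W V" "U \<inter> W = {\<zero>\<^bsub>V\<^esub>}" "submodule_sum U W = carrier V"
proof -
  note lin = linear_map_funpow[OF f]
  note linD = linear_mapD[OF lin]
  obtain d :: "'c set \<Rightarrow> nat"
    where bound: "\<And>U. d U \<le> dim"
      and mono: "\<And>U W. \<lbrakk>subspace K U V; subspace K W V; U \<subset> W\<rbrakk> \<Longrightarrow> d U < d W"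
    by (rule obtains_subspace_rank[OF fd]) blast
  define Ke where "Ke n = {v \<in> carrier V. (f ^^ n) v = \<zero>\<^bsub>V\<^esub>}" for n
  define Im where "Im n = (f ^^ n) ` carrier V" for n
  have Ke_sub: "subspace K (Ke n) V" and Im_sub: "subspace K (Im n) V" for n
    unfolding Ke_def Im_def
    using linear_map.subspace_kernel[OF lin] linear_map.subspace_image[OF lin] by auto
  have Ke_mono: "Ke n \<subseteq> Ke (k + n)" for k n
    unfolding Ke_def by (auto simp: funpow_add linD)
  have Im_mono: "Im (n + k) \<subseteq> Im n" for k n
    unfolding Im_def by (auto simp: funpow_add linD)
  \<comment> \<open>A bounded rank attains its maximum; \<open>Suc dim\<close> appears because the
    bound has to be strict.\<close>
  obtain m where m: "\<And>k. d (Ke k) \<le> d (Ke m)"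
    using ex_has_greatest_nat[of "\<lambda>_. True" 0 "\<lambda>k. d (Ke k)" "Suc dim"] bound by (auto simp: le_imp_less_Suc)
  obtain n where n: "\<And>k. d (Im n) \<le> d (Im k)"
    using ex_has_least_nat[of "\<lambda>_. True" 0 "\<lambda>k. d (Im k)"] by auto
  \<comment> \<open>\<open>Ke (k + m)\<close> contains both \<open>Ke k\<close> and
    \<open>Ke m\<close>, and by the choice of \<open>m\<close> it cannot be strictly larger than
    \<open>Ke m\<close>. The images are treated dually.\<close>
  have Ke_stable: "Ke k \<subseteq> Ke m" for k
  proof -
    have "Ke (k + m) = Ke m"
      using mono[OF Ke_sub Ke_sub, of m "k + m"] Ke_mono[of m k] m[of "k + m"] by fastforce
    then show ?thesis
      using Ke_mono[of k m] by (simp add: add.commute)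
  qed
  have Im_stable: "Im n \<subseteq> Im k" for k
  proof -
    have "Im (n + k) = Im n"
      using mono[OF Im_sub Im_sub, of "n + k" n] Im_mono[of n k] n[of "n + k"] by fastforce
    then show ?thesis
      using Im_mono[of k n] by (simp add: add.commute)
  qed
  have U_eq: "U = Ke m"
    using Ke_stable unfolding U_def Ke_def by auto
  have W_eq: "W = Im n"
    using Im_stable unfolding W_def Im_def by auto
  show "subspace K U V" "subspace K W V"
    unfolding U_eq W_eq by (rule Ke_sub Im_sub)+
  \<comment> \<open>Pull \<open>v\<close> back along the \<open>m\<close>-th power to
    \<open>w\<close>. The \<open>2m\<close>-th power kills \<open>w\<close>, so by stability the
    \<open>m\<close>-th does too, and its value at \<open>w\<close> is \<open>v\<close>.\<close>
  have "v = \<zero>\<^bsub>V\<^esub>" if "v \<in> U" "v \<in> W" for v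
  proof -
    have "v \<in> Im m"
      using that(2) unfolding W_def Im_def by auto
    then obtain w where w: "w \<in> carrier V" "v = (f ^^ m) w"
      unfolding Im_def by auto
    have "w \<in> Ke (m + m)"
      using that(1) w unfolding U_eq Ke_def by (auto simp: funpow_add)
    then have "w \<in> Ke m"
      using Ke_stable by auto
    then show ?thesis
      using w unfolding Ke_def by auto
  qed
  then show "U \<inter> W = {\<zero>\<^bsub>V\<^esub>}"
    using subspaceD(2)[OF Ke_sub] subspaceD(2)[OF Im_sub] unfolding U_eq W_eq by auto
  have "v \<in> submodule_sum U W" if v: "v \<in> carrier V" for v
  proof -
    \<comment> \<open>Stability of the images supplies an \<open>x\<close> in \<open>W\<close> on
      which the \<open>n\<close>-th power agrees with its value at \<open>v\<close>; the rest of
      \<open>v\<close> then lies in \<open>U\<close>.\<close>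
    have "(f ^^ n) v \<in> Im (n + n)"
      using Im_stable v unfolding Im_def by auto
    then obtain w where w: "w \<in> carrier V" "(f ^^ n) v = (f ^^ n) ((f ^^ n) w)"
      unfolding Im_def by (auto simp: funpow_add)
    define x where "x = (f ^^ n) w"
    have x: "x \<in> carrier V" "x \<in> W" "(f ^^ n) v = (f ^^ n) x"
      using w linD unfolding x_def W_eq Im_def by auto
    have "(f ^^ n) (v \<ominus>\<^bsub>V\<^esub> x) = \<zero>\<^bsub>V\<^esub>"
      using v x mod_hom.f_minus[of K V V "f ^^ n" v x] lin[of n]
      unfolding linear_map_def by (simp add: linD M.minus_eq M.r_neg)
    then have "v \<ominus>\<^bsub>V\<^esub> x \<in> U"
      using v x unfolding U_def by auto
    moreover have "v = (v \<ominus>\<^bsub>V\<^esub> x) \<oplus>\<^bsub>V\<^esub> x"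
      using v x by (simp add: M.minus_eq M.a_assoc M.l_neg)
    ultimately show ?thesis
      using x unfolding submodule_sum_def by force
  qed
  moreover have "submodule_sum U W \<subseteq> carrier V"
    unfolding submodule_sum_def U_eq W_eq using subspaceD(1)[OF Ke_sub] subspaceD(1)[OF Im_sub] by fastforce
  ultimately show "submodule_sum U W = carrier V" by auto
qed


lemma (in vectorspace) smult_nonzero:
  assumes "a \<in> carrier K" "v \<in> carrier V" "a \<noteq> \<zero>\<^bsub>K\<^esub>" "v \<noteq> \<zero>\<^bsub>V\<^esub>"
  shows "a \<odot>\<^bsub>V\<^esub> v \<noteq> \<zero>\<^bsub>V\<^esub>"
  using mult_inverse[OF assms(1,2) _ assms(3)] assms by (auto simp: rmult_0)

text \<open>Call \<open>u\<close> reachable from \<open>v\<close> if some member of \<open>E\<close> has image in the line of \<open>u\<close> and does not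
  kill \<open>v\<close>; this is transitive. If nothing were reachable from itself, the span of the vectors
  reachable from \<open>v\<close> would shrink strictly after two steps, contradicting finite dimension.\<close>

lemma (in vectorspace) rank_one_eigenvector:
  assumes fd: fin_dim and nontrivial: "carrier V \<noteq> {\<zero>\<^bsub>V\<^esub>}"
    and lin: "\<And>f. f \<in> E \<Longrightarrow> linear_map K V V f"
    and comp: "\<And>f g. \<lbrakk>f \<in> E; g \<in> E\<rbrakk> \<Longrightarrow> (\<lambda>x. f (g x)) \<in> E"
    and sep: "\<And>v. \<lbrakk>v \<in> carrier V; v \<noteq> \<zero>\<^bsub>V\<^esub>\<rbrakk> \<Longrightarrow>
      \<exists>f\<in>E. f v \<noteq> \<zero>\<^bsub>V\<^esub> \<and> (\<forall>x\<in>carrier V. \<exists>a\<in>carrier K. f x = a \<odot>\<^bsub>V\<^esub> f v)"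
  obtains f u where "f \<in> E" "u \<in> carrier V" "f u \<noteq> \<zero>\<^bsub>V\<^esub>"
    "\<forall>x\<in>carrier V. \<exists>a\<in>carrier K. f x = a \<odot>\<^bsub>V\<^esub> u"
proof -
  define N where "N = carrier V - {\<zero>\<^bsub>V\<^esub>}"
  define reach where "reach v u \<longleftrightarrow>
    u \<in> N \<and> (\<exists>f\<in>E. f v \<noteq> \<zero>\<^bsub>V\<^esub> \<and> (\<forall>x\<in>carrier V. \<exists>a\<in>carrier K. f x = a \<odot>\<^bsub>V\<^esub> u))" for v u
  define S where "S v = span {u. reach v u}" for v
  have reach_V: "{u. reach v u} \<subseteq> carrier V" for v
    unfolding reach_def N_def by auto
  \<comment> \<open>The vector reached is \<open>f v\<close>, for the \<open>f\<close> that
    \<open>sep\<close> provides.\<close>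
  have ex_reach: "\<exists>u. reach v u" if "v \<in> N" for v
    using sep[of v] linear_mapD(3)[OF lin] that unfolding reach_def N_def by auto
  have trans: "reach u w" if u: "u \<in> N" and uv: "reach u v" and vw: "reach v w" for u v w
  proof -
    obtain f where f: "f \<in> E" "f u \<noteq> \<zero>\<^bsub>V\<^esub>" "\<forall>x\<in>carrier V. \<exists>a\<in>carrier K. f x = a \<odot>\<^bsub>V\<^esub> v"
      using uv unfolding reach_def by auto
    obtain g where g: "g \<in> E" "g v \<noteq> \<zero>\<^bsub>V\<^esub>" "\<forall>x\<in>carrier V. \<exists>a\<in>carrier K. g x = a \<odot>\<^bsub>V\<^esub> w"
      using vw unfolding reach_def by auto
    have vV: "v \<in> carrier V" and wN: "w \<in> N" and uV: "u \<in> carrier V"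
      using u uv vw unfolding reach_def N_def by auto
    obtain a where a: "a \<in> carrier K" "f u = a \<odot>\<^bsub>V\<^esub> v"
      using f uV by auto
    \<comment> \<open>Since \<open>f u\<close> is a nonzero multiple of \<open>v\<close>, a map that
      does not kill \<open>v\<close> does not kill \<open>f u\<close>.\<close>
    have "a \<noteq> \<zero>\<^bsub>K\<^esub>"
      using a f(2) vV by (auto simp: lmult_0)
    then have "g (f u) \<noteq> \<zero>\<^bsub>V\<^esub>"
      using a vV g linear_mapD(3,5)[OF lin[OF g(1)]] smult_nonzero by simp
    moreover have "\<forall>x\<in>carrier V. \<exists>a\<in>carrier K. g (f x) = a \<odot>\<^bsub>V\<^esub> w"
      using g(3) linear_mapD(3)[OF lin[OF f(1)]] by auto
    ultimately show ?thesis
      using comp[OF g(1) f(1)] wN unfolding reach_def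
      by (auto intro!: bexI[where x = "\<lambda>x. g (f x)"])
  qed
  have "\<exists>v\<in>N. reach v v"
  proof (rule ccontr)
    assume contr: "\<not> ?thesis"
    obtain d :: "'c set \<Rightarrow> nat"
      where mono: "\<And>U W. \<lbrakk>subspace K U V; subspace K W V; U \<subset> W\<rbrakk> \<Longrightarrow> d U < d W"
      by (rule obtains_subspace_rank[OF fd]) blast
    have "\<exists>v. v \<in> N"
      using nontrivial unfolding N_def by auto
    \<comment> \<open>The start is chosen with \<open>S v\<close> of least rank; after the two steps
      to \<open>u\<close> and \<open>w\<close> the rank will have dropped.\<close>
    then obtain v where v: "v \<in> N" and least: "\<And>w. w \<in> N \<Longrightarrow> d (S v) \<le> d (S w)"
      using ex_has_least_nat[of "\<lambda>v. v \<in> N" _ "\<lambda>v. d (S v)"] by blast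
    obtain u where u: "reach v u" "u \<in> N"
      using ex_reach[OF v] unfolding reach_def by blast
    obtain w where w: "reach u w" "w \<in> N"
      using ex_reach[OF u(2)] unfolding reach_def by blast
    obtain g where g: "g \<in> E" "g u \<noteq> \<zero>\<^bsub>V\<^esub>" "\<forall>x\<in>carrier V. \<exists>a\<in>carrier K. g x = a \<odot>\<^bsub>V\<^esub> w"
      using w unfolding reach_def by auto
    define Z where "Z = {x \<in> carrier V. g x = \<zero>\<^bsub>V\<^esub>}"
    \<comment> \<open>If \<open>g\<close> did not kill \<open>x\<close>, then \<open>x\<close> would
      reach \<open>w\<close>, and \<open>w\<close>, which reaches \<open>x\<close>, would reach
      itself. So \<open>g\<close> vanishes on \<open>S w\<close> but not at \<open>u\<close>, which
      lies in \<open>S v\<close>.\<close>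
    have "reach w x \<Longrightarrow> x \<in> Z" for x
      using trans[of w x w] contr g w(2) unfolding reach_def Z_def N_def by blast
    then have "S w \<subseteq> Z"
      unfolding S_def
      by (intro span_is_subset subspaceD(6)) (auto simp: Z_def intro: linear_map.subspace_kernel lin g)
    moreover have "u \<in> S v"
      unfolding S_def using in_own_span[OF reach_V, of v] u by auto
    moreover have "S w \<subseteq> S v"
      unfolding S_def by (rule span_is_monotone) (use trans v u w in blast)
    ultimately have "S w \<subset> S v"
      using g(2) unfolding Z_def by blast
    then have "d (S w) < d (S v)"
      by (intro mono) (simp_all add: S_def span_is_subspace reach_V)
    then show False
      using least[OF w(2)] by simp
  qed
  then show thesis
    using that unfolding reach_def N_def by blast
qed

section \<open>Projections, inclusions and inverses as linear maps\<close>

text \<open>Two decompositions of a vector differ by an element of the intersection, so the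
  component in \<open>U\<close> is well defined. The target is \<open>vs U\<close> rather than
  \<open>V\<close>, so that the projection composes with maps that are defined on \<open>U\<close>
  only.\<close>

lemma (in vectorspace) complement_projection:
  assumes U: "subspace K U V" and W: "subspace K W V"
    and int: "U \<inter> W = {\<zero>\<^bsub>V\<^esub>}" and sum: "submodule_sum U W = carrier V"
  obtains p where "linear_map K V (vs U) p" "\<And>u w. \<lbrakk>u \<in> U; w \<in> W\<rbrakk> \<Longrightarrow> p (u \<oplus>\<^bsub>V\<^esub> w) = u"
proof -
  note UD = subspaceD[OF U] and WD = subspaceD[OF W]
  define p where "p v = (THE u. u \<in> U \<and> (\<exists>w\<in>W. v = u \<oplus>\<^bsub>V\<^esub> w))" for v
  have uniq: "u = u'" if "u \<in> U" "u' \<in> U" "w \<in> W" "w' \<in> W" "u \<oplus>\<^bsub>V\<^esub> w = u' \<oplus>\<^bsub>V\<^esub> w'" for u u' w w'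
  proof -
    have in_V: "u \<in> carrier V" "u' \<in> carrier V" "w \<in> carrier V" "w' \<in> carrier V"
      using that UD(1) WD(1) by auto
    \<comment> \<open>The subspace facts cover addition and scalar multiples only, so negation is
      written as a scalar multiple.\<close>
    have neg: "\<ominus>\<^bsub>V\<^esub> x = (\<ominus>\<^bsub>K\<^esub> \<one>\<^bsub>K\<^esub>) \<odot>\<^bsub>V\<^esub> x" if "x \<in> carrier V" for x
      using that by (simp add: smult_minus_1)
    \<comment> \<open>This difference is also \<open>u\<close> minus \<open>u'\<close>, hence lies
      in both subspaces and vanishes.\<close>
    define x where "x = w' \<ominus>\<^bsub>V\<^esub> w"
    have x: "x \<in> W" "x \<in> carrier V"
      using that in_V WD(3,4) unfolding x_def by (simp_all add: M.minus_eq neg)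
    have "u = (u \<oplus>\<^bsub>V\<^esub> w) \<oplus>\<^bsub>V\<^esub> \<ominus>\<^bsub>V\<^esub> w"
      using in_V by (simp add: M.a_assoc M.r_neg)
    then have u_eq: "u = u' \<oplus>\<^bsub>V\<^esub> x"
      using in_V unfolding that(5) x_def by (simp add: M.a_assoc M.minus_eq)
    then have "x = \<ominus>\<^bsub>V\<^esub> u' \<oplus>\<^bsub>V\<^esub> u"
      using in_V x by (simp add: M.r_neg1)
    then have "x \<in> U"
      using that in_V UD(3,4) by (simp add: neg)
    then have "x = \<zero>\<^bsub>V\<^esub>"
      using x int by auto
    then show ?thesis
      using u_eq in_V by simp
  qed
  have p: "p (u \<oplus>\<^bsub>V\<^esub> w) = u" if "u \<in> U" "w \<in> W" for u w
    unfolding p_def by (rule the_equality) (use that uniq in blast)+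
  have ex: "\<exists>u\<in>U. \<exists>w\<in>W. v = u \<oplus>\<^bsub>V\<^esub> w" if "v \<in> carrier V" for v
    using that unfolding sum[symmetric] submodule_sum_def by auto
  have "linear_map K V (vs U) p"
  proof (rule linear_mapI)
    show "vectorspace K V" "vectorspace K (vs U)"
      using vectorspace_axioms subspace_is_vs[OF U] by auto
    show "p v \<in> carrier (vs U)" if "v \<in> carrier V" for v
      using ex[OF that] p by auto
    show "p (v \<oplus>\<^bsub>V\<^esub> v') = p v \<oplus>\<^bsub>vs U\<^esub> p v'" if v: "v \<in> carrier V" "v' \<in> carrier V" for v v'
    proof -
      obtain u w u' w' where uw: "u \<in> U" "w \<in> W" "v = u \<oplus>\<^bsub>V\<^esub> w" "u' \<in> U" "w' \<in> W" "v' = u' \<oplus>\<^bsub>V\<^esub> w'"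
        using ex[OF v(1)] ex[OF v(2)] by blast
      then have "v \<oplus>\<^bsub>V\<^esub> v' = (u \<oplus>\<^bsub>V\<^esub> u') \<oplus>\<^bsub>V\<^esub> (w \<oplus>\<^bsub>V\<^esub> w')"
        using UD(1) WD(1) by (simp add: M.a_ac subset_iff)
      then show ?thesis
        using uw UD(3) WD(3) p by simp
    qed
    show "p (c \<odot>\<^bsub>V\<^esub> v) = c \<odot>\<^bsub>vs U\<^esub> p v" if v: "c \<in> carrier K" "v \<in> carrier V" for c v
    proof -
      obtain u w where uw: "u \<in> U" "w \<in> W" "v = u \<oplus>\<^bsub>V\<^esub> w"
        using ex[OF v(2)] by blast
      then have "c \<odot>\<^bsub>V\<^esub> v = c \<odot>\<^bsub>V\<^esub> u \<oplus>\<^bsub>V\<^esub> c \<odot>\<^bsub>V\<^esub> w"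
        using v UD(1) WD(1) by (simp add: smult_r_distr subset_iff)
      then show ?thesis
        using uw v UD(4) WD(4) p by simp
    qed
  qed
  then show thesis
    using that p by blast
qed

lemma (in vectorspace) linear_map_inclusion:
  assumes "subspace K U V"
  shows "linear_map K (vs U) V (\<lambda>x. x)"
  by (rule linear_mapI) (use assms subspaceD(1)[OF assms] vectorspace_axioms subspace_is_vs in auto)

lemma linear_map_inv_into:
  assumes T: "linear_map K V W T" and bij: "bij_betw T (carrier V) (carrier W)"
  shows "linear_map K W V (inv_into (carrier V) T)"
proof -
  note TD = linear_mapD[OF T]
  interpret V: vectorspace K V by (rule TD)
  have inv: "inv_into (carrier V) T w \<in> carrier V" "T (inv_into (carrier V) T w) = w" if "w \<in> carrier W" for w
    using that bij by (auto simp: bij_betw_def inv_into_into f_inv_into_f)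
  have inv_eq: "inv_into (carrier V) T w = v" if "v \<in> carrier V" "T v = w" for v w
    using that bij by (auto simp: bij_betw_def)
  show ?thesis
    by (rule linear_mapI) (auto intro!: inv_eq simp: TD inv)
qed

lemma linear_map_finsum:
  assumes T: "linear_map K V W T" and "finite A" "g \<in> A \<rightarrow> carrier V"
  shows "T (\<Oplus>\<^bsub>V\<^esub>a\<in>A. g a) = (\<Oplus>\<^bsub>W\<^esub>a\<in>A. T (g a))"
proof -
  note TD = linear_mapD[OF T]
  interpret V: vectorspace K V by (rule TD)
  interpret W: vectorspace K W by (rule TD)
  show ?thesis
    using assms(2,3)
  proof (induction A rule: finite_induct)
    case (insert a A)
    then have "g \<in> A \<rightarrow> carrier V" "g a \<in> carrier V" "(\<lambda>a. T (g a)) \<in> A \<rightarrow> carrier W" "T (g a) \<in> carrier W"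
      using TD(3) by auto
    with insert show ?case
      by (simp add: TD)
  qed (simp add: TD)
qed

section \<open>Homomorphisms of representations\<close>

text \<open>Natural transformations. The two vector types are independent, because vectors of a free
  representation are functions into the field. Linearity of the components already makes the spaces
  on both sides vector spaces, so functoriality need not be assumed in the lemmas below.\<close>

definition rep_hom ::
  "('k, 'r) ring_scheme \<Rightarrow> ('o, 'm) cat \<Rightarrow> ('o, 'm, 'k, 'v) vect_rep \<Rightarrow> ('o, 'm, 'k, 'w) vect_rep
    \<Rightarrow> ('o \<Rightarrow> 'v \<Rightarrow> 'w) \<Rightarrow> bool" where
  "rep_hom K X R Q \<eta> \<longleftrightarrow>
    (\<forall>a\<in>Obj X. linear_map K (ob R a) (ob Q a) (\<eta> a)) \<and>
    (\<forall>f\<in>Mor X. \<forall>v\<in>carrier (ob R (Src X f)).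
       \<eta> (Tgt X f) (ar R f v) = ar Q f (\<eta> (Src X f) v))"

lemma rep_homD:
  assumes "rep_hom K X R Q \<eta>"
  shows "a \<in> Obj X \<Longrightarrow> linear_map K (ob R a) (ob Q a) (\<eta> a)"
    and "\<lbrakk>f \<in> Mor X; v \<in> carrier (ob R (Src X f))\<rbrakk> \<Longrightarrow>
      \<eta> (Tgt X f) (ar R f v) = ar Q f (\<eta> (Src X f) v)"
  using assms unfolding rep_hom_def by auto

context category
begin

lemma rep_hom_comp:
  assumes "rep_hom K X P Q \<eta>" "rep_hom K X Q R \<theta>"
  shows "rep_hom K X P R (\<lambda>a x. \<theta> a (\<eta> a x))"
  unfolding rep_hom_def
proof (intro conjI ballI)
  show "linear_map K (ob P a) (ob R a) (\<lambda>x. \<theta> a (\<eta> a x))" if "a \<in> Obj X" for a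
    by (rule linear_map_comp[OF rep_homD(1)[OF assms(1) that] rep_homD(1)[OF assms(2) that]])
  show "\<theta> (Tgt X f) (\<eta> (Tgt X f) (ar P f v)) = ar R f (\<theta> (Src X f) (\<eta> (Src X f) v))"
    if f: "f \<in> Mor X" and v: "v \<in> carrier (ob P (Src X f))" for f v
    using rep_homD(2)[OF assms(1) f v] rep_homD(2)[OF assms(2) f]
      linear_mapD(3)[OF rep_homD(1)[OF assms(1) Src_in[OF f]] v]
    by simp
qed

lemma rep_hom_inclusion:
  assumes "subrep K X R U"
  shows "rep_hom K X (rep_restrict R U) R (\<lambda>_ x. x)"
  using assms subspaceD(5)[of K _ "ob R _"] vectorspace.linear_map_inclusion[of K "ob R _"]
  unfolding rep_hom_def subrep_def rep_restrict_def by simp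

text \<open>Inverting the naturality square of \<open>\<eta>\<close> gives that of the inverse.
  \<open>closed\<close> keeps \<open>ar R f v\<close> in the carrier, where \<open>inv_into\<close>
  cancels \<open>\<eta>\<close>.\<close>

lemma rep_hom_inverse:
  assumes \<eta>: "rep_hom K X R Q \<eta>"
    and bij: "\<And>a. a \<in> Obj X \<Longrightarrow> bij_betw (\<eta> a) (carrier (ob R a)) (carrier (ob Q a))"
    and closed: "\<And>f. f \<in> Mor X \<Longrightarrow> ar R f \<in> carrier (ob R (Src X f)) \<rightarrow> carrier (ob R (Tgt X f))"
  shows "rep_hom K X Q R (\<lambda>a. inv_into (carrier (ob R a)) (\<eta> a))"
  unfolding rep_hom_def
proof (intro conjI ballI)
  show "linear_map K (ob Q a) (ob R a) (inv_into (carrier (ob R a)) (\<eta> a))" if "a \<in> Obj X" for a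
    by (rule linear_map_inv_into[OF rep_homD(1)[OF \<eta> that] bij[OF that]])
  fix f w assume f: "f \<in> Mor X" and w: "w \<in> carrier (ob Q (Src X f))"
  note src = Src_in[OF f] and tgt = Tgt_in[OF f]
  obtain v where v: "v \<in> carrier (ob R (Src X f))" "w = \<eta> (Src X f) v"
    using w bij[OF src] by (auto simp: bij_betw_def)
  have "inv_into (carrier (ob R (Src X f))) (\<eta> (Src X f)) w = v"
    using v bij[OF src] by (simp add: bij_betw_def)
  moreover have "inv_into (carrier (ob R (Tgt X f))) (\<eta> (Tgt X f)) (ar Q f w) = ar R f v"
    unfolding v(2) rep_homD(2)[OF \<eta> f v(1), symmetric]
    by (rule bij_betw_inv_into_left[OF bij[OF tgt] funcset_mem[OF closed[OF f] v(1)]])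
  ultimately show "inv_into (carrier (ob R (Tgt X f))) (\<eta> (Tgt X f)) (ar Q f w) =
      ar R f (inv_into (carrier (ob R (Src X f))) (\<eta> (Src X f)) w)"
    by simp
qed

text \<open>Assuming only additivity of the maps makes this applicable to a free representation
  without first proving that it is a functor.\<close>

lemma direct_sum2_projection:
  assumes sum: "direct_sum2 K X R U W"
    and add: "\<And>f v w. \<lbrakk>f \<in> Mor X; v \<in> carrier (ob R (Src X f)); w \<in> carrier (ob R (Src X f))\<rbrakk>
      \<Longrightarrow> ar R f (v \<oplus>\<^bsub>ob R (Src X f)\<^esub> w) = ar R f v \<oplus>\<^bsub>ob R (Tgt X f)\<^esub> ar R f w"
  obtains p where "rep_hom K X R (rep_restrict R U) p"
    "\<And>a u w. \<lbrakk>a \<in> Obj X; u \<in> U a; w \<in> W a\<rbrakk> \<Longrightarrow> p a (u \<oplus>\<^bsub>ob R a\<^esub> w) = u"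
proof -
  have sub: "subspace K (U a) (ob R a)" "subspace K (W a) (ob R a)" if "a \<in> Obj X" for a
    using sum that unfolding direct_sum2_def subrep_def by auto
  have ex: "\<exists>q. linear_map K (ob R a) (ob R a\<lparr>carrier := U a\<rparr>) q \<and>
      (\<forall>u\<in>U a. \<forall>w\<in>W a. q (u \<oplus>\<^bsub>ob R a\<^esub> w) = u)" if a: "a \<in> Obj X" for a
  proof -
    have "U a \<inter> W a = {\<zero>\<^bsub>ob R a\<^esub>}" "module.submodule_sum (ob R a) (U a) (W a) = carrier (ob R a)"
      using sum a unfolding direct_sum2_def by simp_all
    then obtain q where "linear_map K (ob R a) (ob R a\<lparr>carrier := U a\<rparr>) q"
      "\<And>u w. \<lbrakk>u \<in> U a; w \<in> W a\<rbrakk> \<Longrightarrow> q (u \<oplus>\<^bsub>ob R a\<^esub> w) = u"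
      by (rule vectorspace.complement_projection[OF subspaceD(5)[OF sub(1)[OF a]] sub[OF a]]) blast
    then show ?thesis by blast
  qed
  define p where "p a = (SOME q. linear_map K (ob R a) (ob R a\<lparr>carrier := U a\<rparr>) q \<and>
      (\<forall>u\<in>U a. \<forall>w\<in>W a. q (u \<oplus>\<^bsub>ob R a\<^esub> w) = u))" for a
  have p: "linear_map K (ob R a) (ob R a\<lparr>carrier := U a\<rparr>) (p a)"
      "\<lbrakk>u \<in> U a; w \<in> W a\<rbrakk> \<Longrightarrow> p a (u \<oplus>\<^bsub>ob R a\<^esub> w) = u" if a: "a \<in> Obj X" for a u w
    using someI_ex[OF ex[OF a]] unfolding p_def[symmetric] by auto
  have "p (Tgt X f) (ar R f v) = ar R f (p (Src X f) v)"
    if f: "f \<in> Mor X" and v: "v \<in> carrier (ob R (Src X f))" for f v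
  proof -
    note src = Src_in[OF f] and tgt = Tgt_in[OF f]
    interpret V: vectorspace K "ob R (Src X f)"
      by (rule subspaceD(5)[OF sub(1)[OF src]])
    have "v \<in> V.submodule_sum (U (Src X f)) (W (Src X f))"
      using v sum src unfolding direct_sum2_def by simp
    then obtain u w where uw: "u \<in> U (Src X f)" "w \<in> W (Src X f)" "v = u \<oplus>\<^bsub>ob R (Src X f)\<^esub> w"
      unfolding V.submodule_sum_def by auto
    \<comment> \<open>Both summands are stable, so the components of the image are the images of the
      components.\<close>
    have "ar R f u \<in> U (Tgt X f)" "ar R f w \<in> W (Tgt X f)"
      using sum f uw unfolding direct_sum2_def subrep_def by auto
    moreover have "ar R f v = ar R f u \<oplus>\<^bsub>ob R (Tgt X f)\<^esub> ar R f w"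
      using add[OF f] uw subspaceD(1)[OF sub(1)[OF src]] subspaceD(1)[OF sub(2)[OF src]] by auto
    ultimately show ?thesis
      using p(2)[OF src uw(1,2)] p(2)[OF tgt] uw(3) by simp
  qed
  then have "rep_hom K X R (rep_restrict R U) p"
    unfolding rep_hom_def rep_restrict_def using p(1) by simp
  then show thesis
    using that p(2) by blast
qed

end

section \<open>Projections of a finite direct sum onto its summands\<close>

text \<open>The tuple of components is unique. Adding, scaling or transporting tuples gives tuples
  with the right sum, so uniqueness makes the components linear and natural. A vector all of whose
  components vanish is an empty or zero sum.\<close>

lemma (in vect_rep) direct_sum_decomp_projection:
  assumes dec: "direct_sum_decomp K X R n U"
  obtains p where "\<And>i. i < n \<Longrightarrow> rep_hom K X R (rep_restrict R (U i)) (p i)"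
    "\<And>a v. \<lbrakk>a \<in> Obj X; v \<in> carrier (ob R a); v \<noteq> \<zero>\<^bsub>ob R a\<^esub>\<rbrakk> \<Longrightarrow> \<exists>i<n. p i a v \<noteq> \<zero>\<^bsub>ob R a\<^esub>"
proof -
  define c where "c a v = (THE u. u \<in> (\<Pi>\<^sub>E i\<in>{..<n}. U i a) \<and> v = (\<Oplus>\<^bsub>ob R a\<^esub>i\<in>{..<n}. u i))" for a v
  define p where "p i a v = c a v i" for i a v
  have sr: "subrep K X R (U i)" if "i < n" for i
    using dec that unfolding direct_sum_decomp_def by auto
  have ar_U: "ar R f x \<in> U i (Tgt X f)" if "f \<in> Mor X" "i < n" "x \<in> U i (Src X f)" for f i x
    using sr[OF that(2)] that(1,3) unfolding subrep_def by (auto intro: funcset_mem)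
  have sub: "subspace K (U i a) (ob R a)" if "i < n" "a \<in> Obj X" for i a
    using sr that unfolding subrep_def by auto
  have U_V: "u i \<in> carrier (ob R a)" if "u \<in> (\<Pi>\<^sub>E i\<in>{..<n}. U i a)" "i < n" "a \<in> Obj X" for u i a
    using subspaceD(1)[OF sub[OF that(2,3)]] that by auto
  have ex1: "\<exists>!u. u \<in> (\<Pi>\<^sub>E i\<in>{..<n}. U i a) \<and> v = (\<Oplus>\<^bsub>ob R a\<^esub>i\<in>{..<n}. u i)"
    if "a \<in> Obj X" "v \<in> carrier (ob R a)" for a v
    using dec that unfolding direct_sum_decomp_def by auto
  have c: "c a v \<in> (\<Pi>\<^sub>E i\<in>{..<n}. U i a)" "(\<Oplus>\<^bsub>ob R a\<^esub>i\<in>{..<n}. c a v i) = v"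
    if "a \<in> Obj X" "v \<in> carrier (ob R a)" for a v
    using theI'[OF ex1[OF that]] unfolding c_def by auto
  have cU: "c a v i \<in> U i a" if "a \<in> Obj X" "v \<in> carrier (ob R a)" "i < n" for a v i
    using PiE_mem[OF c(1)[OF that(1,2)], of i] that(3) by simp
  have c_eq: "c a v = u"
    if "a \<in> Obj X" "v \<in> carrier (ob R a)" "u \<in> (\<Pi>\<^sub>E i\<in>{..<n}. U i a)"
      "v = (\<Oplus>\<^bsub>ob R a\<^esub>i\<in>{..<n}. u i)" for a v u
    using ex1[OF that(1,2)] that(3,4) c[OF that(1,2)] by metis
  \<comment> \<open>The tuple is restricted to \<open>{..<n}\<close> because uniqueness holds only
    among extensional functions.\<close>
  have c_add: "c a (v \<oplus>\<^bsub>ob R a\<^esub> w) = (\<lambda>i\<in>{..<n}. c a v i \<oplus>\<^bsub>ob R a\<^esub> c a w i)"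
    if a: "a \<in> Obj X" and v: "v \<in> carrier (ob R a)" and w: "w \<in> carrier (ob R a)" for a v w
  proof (rule c_eq[OF a])
    interpret V: vectorspace K "ob R a" by (rule ob_vectorspace[OF a])
    show "v \<oplus>\<^bsub>ob R a\<^esub> w \<in> carrier (ob R a)"
      using v w by simp
    show "(\<lambda>i\<in>{..<n}. c a v i \<oplus>\<^bsub>ob R a\<^esub> c a w i) \<in> (\<Pi>\<^sub>E i\<in>{..<n}. U i a)"
      using cU[OF a v] cU[OF a w] subspaceD(3)[OF sub[OF _ a]] by (simp add: PiE_iff)
    have "(\<Oplus>\<^bsub>ob R a\<^esub>i\<in>{..<n}. (\<lambda>i\<in>{..<n}. c a v i \<oplus>\<^bsub>ob R a\<^esub> c a w i) i) =
        (\<Oplus>\<^bsub>ob R a\<^esub>i\<in>{..<n}. c a v i \<oplus>\<^bsub>ob R a\<^esub> c a w i)"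
      using U_V[OF c(1)[OF a v] _ a] U_V[OF c(1)[OF a w] _ a] by (intro V.M.finsum_cong') auto
    also have "\<dots> = v \<oplus>\<^bsub>ob R a\<^esub> w"
      using U_V[OF c(1)[OF a v] _ a] U_V[OF c(1)[OF a w] _ a]
      by (subst V.M.finsum_addf) (auto simp: c(2)[OF a v] c(2)[OF a w])
    finally show "v \<oplus>\<^bsub>ob R a\<^esub> w =
        (\<Oplus>\<^bsub>ob R a\<^esub>i\<in>{..<n}. (\<lambda>i\<in>{..<n}. c a v i \<oplus>\<^bsub>ob R a\<^esub> c a w i) i)" by simp
  qed
  have c_smult: "c a (k \<odot>\<^bsub>ob R a\<^esub> v) = (\<lambda>i\<in>{..<n}. k \<odot>\<^bsub>ob R a\<^esub> c a v i)"
    if a: "a \<in> Obj X" and v: "v \<in> carrier (ob R a)" and k: "k \<in> carrier K" for a v k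
  proof (rule c_eq[OF a])
    interpret V: vectorspace K "ob R a" by (rule ob_vectorspace[OF a])
    show "k \<odot>\<^bsub>ob R a\<^esub> v \<in> carrier (ob R a)"
      using v k by simp
    show "(\<lambda>i\<in>{..<n}. k \<odot>\<^bsub>ob R a\<^esub> c a v i) \<in> (\<Pi>\<^sub>E i\<in>{..<n}. U i a)"
      using cU[OF a v] subspaceD(4)[OF sub[OF _ a]] k by (simp add: PiE_iff)
    have "(\<Oplus>\<^bsub>ob R a\<^esub>i\<in>{..<n}. (\<lambda>i\<in>{..<n}. k \<odot>\<^bsub>ob R a\<^esub> c a v i) i) =
        (\<Oplus>\<^bsub>ob R a\<^esub>i\<in>{..<n}. k \<odot>\<^bsub>ob R a\<^esub> c a v i)"
      using U_V[OF c(1)[OF a v] _ a] k by (intro V.M.finsum_cong') auto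
    also have "\<dots> = k \<odot>\<^bsub>ob R a\<^esub> v"
      using U_V[OF c(1)[OF a v] _ a] k
      by (subst V.finsum_smult[symmetric]) (auto simp: c(2)[OF a v])
    finally show "k \<odot>\<^bsub>ob R a\<^esub> v =
        (\<Oplus>\<^bsub>ob R a\<^esub>i\<in>{..<n}. (\<lambda>i\<in>{..<n}. k \<odot>\<^bsub>ob R a\<^esub> c a v i) i)" by simp
  qed
  have c_ar: "c (Tgt X f) (ar R f v) = (\<lambda>i\<in>{..<n}. ar R f (c (Src X f) v i))"
    if f: "f \<in> Mor X" and v: "v \<in> carrier (ob R (Src X f))" for f v
  proof (rule c_eq[OF Tgt_in[OF f]])
    note src = Src_in[OF f] and tgt = Tgt_in[OF f] and lin = linear_mapD[OF ar_linear[OF f]]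
    interpret W: vectorspace K "ob R (Tgt X f)" by (rule ob_vectorspace[OF tgt])
    note cV = U_V[OF c(1)[OF src v] _ src]
    show "ar R f v \<in> carrier (ob R (Tgt X f))"
      using v lin by simp
    show "(\<lambda>i\<in>{..<n}. ar R f (c (Src X f) v i)) \<in> (\<Pi>\<^sub>E i\<in>{..<n}. U i (Tgt X f))"
      using cU[OF src v] ar_U[OF f] by (simp add: PiE_iff)
    have "(\<Oplus>\<^bsub>ob R (Tgt X f)\<^esub>i\<in>{..<n}. (\<lambda>i\<in>{..<n}. ar R f (c (Src X f) v i)) i) =
        (\<Oplus>\<^bsub>ob R (Tgt X f)\<^esub>i\<in>{..<n}. ar R f (c (Src X f) v i))"
      using cV lin(3) by (intro W.M.finsum_cong') auto
    also have "\<dots> = ar R f (\<Oplus>\<^bsub>ob R (Src X f)\<^esub>i\<in>{..<n}. c (Src X f) v i)"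
      using cV by (intro linear_map_finsum[OF ar_linear[OF f], symmetric]) auto
    also have "\<dots> = ar R f v"
      using c(2)[OF src v] by simp
    finally show "ar R f v =
        (\<Oplus>\<^bsub>ob R (Tgt X f)\<^esub>i\<in>{..<n}. (\<lambda>i\<in>{..<n}. ar R f (c (Src X f) v i)) i)" by simp
  qed
  have "linear_map K (ob R a) (ob R a\<lparr>carrier := U i a\<rparr>) (p i a)" if i: "i < n" and a: "a \<in> Obj X" for i a
  proof (rule linear_mapI)
    show "vectorspace K (ob R a)" "vectorspace K (ob R a\<lparr>carrier := U i a\<rparr>)"
      using ob_vectorspace[OF a] vectorspace.subspace_is_vs sub[OF i a] by auto
  qed (use i cU[OF a] c_add[OF a] c_smult[OF a] in \<open>auto simp: p_def\<close>)
  moreover have "p i (Tgt X f) (ar R f v) = ar R f (p i (Src X f) v)"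
    if "i < n" "f \<in> Mor X" "v \<in> carrier (ob R (Src X f))" for i f v
    using c_ar that unfolding p_def by simp
  ultimately have "rep_hom K X R (rep_restrict R (U i)) (p i)" if "i < n" for i
    using that unfolding rep_hom_def rep_restrict_def by simp
  moreover have "\<exists>i<n. p i a v \<noteq> \<zero>\<^bsub>ob R a\<^esub>"
    if a: "a \<in> Obj X" and v: "v \<in> carrier (ob R a)" and nz: "v \<noteq> \<zero>\<^bsub>ob R a\<^esub>" for a v
  proof (rule ccontr)
    assume "\<not> ?thesis"
    then have zero: "c a v i = \<zero>\<^bsub>ob R a\<^esub>" if "i < n" for i
      using that unfolding p_def by auto
    interpret V: vectorspace K "ob R a" by (rule ob_vectorspace[OF a])
    have "(\<Oplus>\<^bsub>ob R a\<^esub>i\<in>{..<n}. c a v i) = (\<Oplus>\<^bsub>ob R a\<^esub>i\<in>{..<n}. \<zero>\<^bsub>ob R a\<^esub>)"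
      using zero by (intro V.M.finsum_cong') auto
    then show False
      using c(2)[OF a v] nz by simp
  qed
  ultimately show thesis
    using that by blast
qed

section \<open>Fitting's lemma for an indecomposable representation\<close>

text \<open>The vector \<open>u\<close> is a multiple of \<open>\<phi> t u\<close> and so survives
  in the stable image. Indecomposability then makes the nilpotent part vanish, and an injective map
  into a line has a source of dimension at most one.\<close>

lemma (in fin_dim_vect_rep) dim_le_1_if_rank_one_eigenvector:
  assumes indec: "indecomposable K X R" and \<phi>: "rep_hom K X R R \<phi>" and t: "t \<in> Obj X"
    and u: "u \<in> carrier (ob R t)" "\<phi> t u \<noteq> \<zero>\<^bsub>ob R t\<^esub>"
    and rank: "\<forall>x\<in>carrier (ob R t). \<exists>a\<in>carrier K. \<phi> t x = a \<odot>\<^bsub>ob R t\<^esub> u"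
  shows "vectorspace.dim K (ob R t) \<le> 1"
proof -
  interpret V: vectorspace K "ob R t" by (rule ob_vectorspace[OF t])
  note lin = rep_homD(1)[OF \<phi>] and nat = rep_homD(2)[OF \<phi>]
  note linD = linear_mapD[OF lin]
  define U where "U a = {v \<in> carrier (ob R a). \<exists>n. (\<phi> a ^^ n) v = \<zero>\<^bsub>ob R a\<^esub>}" for a
  define W where "W a = (\<Inter>n. (\<phi> a ^^ n) ` carrier (ob R a))" for a
  have pow_closed: "(\<phi> a ^^ n) v \<in> carrier (ob R a)" if "a \<in> Obj X" "v \<in> carrier (ob R a)" for a n v
    using that by (induction n) (auto simp: linD)
  have pow_nat: "(\<phi> (Tgt X f) ^^ n) (ar R f v) = ar R f ((\<phi> (Src X f) ^^ n) v)"
    if f: "f \<in> Mor X" and v: "v \<in> carrier (ob R (Src X f))" for f n v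
    by (induction n) (use nat[OF f] pow_closed[OF Src_in[OF f] v] in auto)
  note ar_D = linear_mapD[OF ar_linear]
  note fit = vectorspace.fitting_decomposition[OF ob_vectorspace fin_dim lin, folded U_def W_def]
  \<comment> \<open>Naturality of the powers preserves kernels and images for each exponent, so the
    objectwise decompositions form subrepresentations.\<close>
  have "ar R f v \<in> U (Tgt X f)" if f: "f \<in> Mor X" and v: "v \<in> U (Src X f)" for f v
  proof -
    obtain n where "v \<in> carrier (ob R (Src X f))" "(\<phi> (Src X f) ^^ n) v = \<zero>\<^bsub>ob R (Src X f)\<^esub>"
      using v unfolding U_def by auto
    then show ?thesis
      using pow_nat[OF f, of v n] ar_D[OF f] unfolding U_def by auto
  qed
  moreover have "ar R f v \<in> W (Tgt X f)" if f: "f \<in> Mor X" and v: "v \<in> W (Src X f)" for f v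
    unfolding W_def
  proof
    fix n
    obtain w where "w \<in> carrier (ob R (Src X f))" "v = (\<phi> (Src X f) ^^ n) w"
      using v unfolding W_def by auto
    then show "ar R f v \<in> (\<phi> (Tgt X f) ^^ n) ` carrier (ob R (Tgt X f))"
      using pow_nat[OF f, of w n] ar_D(3)[OF f, of w] by (intro image_eqI[of _ _ "ar R f w"]) simp_all
  qed
  ultimately have "direct_sum2 K X R U W"
    unfolding direct_sum2_def subrep_def using fit by auto
  then consider "zero_rep X (rep_restrict R U)" | "zero_rep X (rep_restrict R W)"
    using indec unfolding indecomposable_def by blast
  then have U_or_W: "U t = {\<zero>\<^bsub>ob R t\<^esub>} \<or> W t = {\<zero>\<^bsub>ob R t\<^esub>}"
    using t unfolding zero_rep_def rep_restrict_def by cases auto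
  obtain c where c: "c \<in> carrier K" "\<phi> t u = c \<odot>\<^bsub>ob R t\<^esub> u"
    using rank u by auto
  have c0: "c \<noteq> \<zero>\<^bsub>K\<^esub>" and u0: "u \<noteq> \<zero>\<^bsub>ob R t\<^esub>"
    using c u linD(6)[OF t] by auto
  have inv: "inv\<^bsub>K\<^esub> c \<in> carrier K" "inv\<^bsub>K\<^esub> c \<otimes>\<^bsub>K\<^esub> c = \<one>\<^bsub>K\<^esub>"
    using c c0 field_Units by auto
  \<comment> \<open>On the line of \<open>u\<close> the map scales by the nonzero \<open>c\<close>.
    Dividing by \<open>c\<close> gives preimages within the line, and iterating puts
    \<open>u\<close> into every image.\<close>
  have preimage: "\<phi> t ((a \<otimes>\<^bsub>K\<^esub> inv\<^bsub>K\<^esub> c) \<odot>\<^bsub>ob R t\<^esub> u) = a \<odot>\<^bsub>ob R t\<^esub> u" if a: "a \<in> carrier K" for a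
  proof -
    have "\<phi> t ((a \<otimes>\<^bsub>K\<^esub> inv\<^bsub>K\<^esub> c) \<odot>\<^bsub>ob R t\<^esub> u) = ((a \<otimes>\<^bsub>K\<^esub> inv\<^bsub>K\<^esub> c) \<otimes>\<^bsub>K\<^esub> c) \<odot>\<^bsub>ob R t\<^esub> u"
      using a c u inv by (simp add: linD(5)[OF t] V.smult_assoc1)
    then show ?thesis
      using a c inv by (simp add: m_assoc)
  qed
  have "a \<odot>\<^bsub>ob R t\<^esub> u \<in> (\<phi> t ^^ n) ` carrier (ob R t)" if "a \<in> carrier K" for a n
    using that
  proof (induction n arbitrary: a)
    case (Suc n)
    have "a \<otimes>\<^bsub>K\<^esub> inv\<^bsub>K\<^esub> c \<in> carrier K"
      using Suc.prems inv by simp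
    from Suc.IH[OF this] obtain y where y: "y \<in> carrier (ob R t)"
      "(a \<otimes>\<^bsub>K\<^esub> inv\<^bsub>K\<^esub> c) \<odot>\<^bsub>ob R t\<^esub> u = (\<phi> t ^^ n) y"
      by (rule imageE)
    have "a \<odot>\<^bsub>ob R t\<^esub> u = (\<phi> t ^^ Suc n) y"
      using preimage[OF Suc.prems] y(2) by simp
    then show ?case
      using y(1) by (rule image_eqI)
  qed (use u in simp)
  from this[of "\<one>\<^bsub>K\<^esub>"] have "u \<in> W t"
    unfolding W_def using u by simp
  then have U0: "U t = {\<zero>\<^bsub>ob R t\<^esub>}"
    using U_or_W u0 by auto
  have "v \<in> V.span {u}" if v: "v \<in> carrier (ob R t)" for v
  proof -
    obtain a where a: "a \<in> carrier K" "\<phi> t v = a \<odot>\<^bsub>ob R t\<^esub> u"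
      using rank v by auto
    \<comment> \<open>The vector on the line of \<open>u\<close> with the same image as
      \<open>v\<close>; the difference lies in the nilpotent part, with exponent 1.\<close>
    define w where "w = (a \<otimes>\<^bsub>K\<^esub> inv\<^bsub>K\<^esub> c) \<odot>\<^bsub>ob R t\<^esub> u"
    have w: "w \<in> carrier (ob R t)" "\<phi> t w = \<phi> t v"
      using a inv u preimage unfolding w_def by auto
    have "\<phi> t (v \<ominus>\<^bsub>ob R t\<^esub> w) = \<zero>\<^bsub>ob R t\<^esub>"
      using v w lin[OF t] mod_hom.f_minus[of K "ob R t" "ob R t" "\<phi> t" v w]
      unfolding linear_map_def by (simp add: linD(3)[OF t] V.M.minus_eq V.M.r_neg)
    then have "(\<phi> t ^^ 1) (v \<ominus>\<^bsub>ob R t\<^esub> w) = \<zero>\<^bsub>ob R t\<^esub>"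
      by simp
    then have "v \<ominus>\<^bsub>ob R t\<^esub> w \<in> U t"
      using v w unfolding U_def by (auto intro!: exI[of _ 1])
    then have "v = w"
      using v w unfolding U0 by simp
    moreover have "u \<in> V.span {u}"
      using u by (simp add: V.span_self)
    moreover have "subspace K (V.span {u}) (ob R t)"
      using u by (intro V.span_is_subspace) auto
    ultimately show ?thesis
      using a inv subspaceD(4) unfolding w_def by force
  qed
  then have "V.span {u} = carrier (ob R t)"
    using V.span_is_subset2[of "{u}"] u by auto
  then show ?thesis
    using V.dim_le1I u by blast
qed

section \<open>Free representations and their fibres\<close>

context field
begin

lemma free_space_simps:
  "carrier (free_space R A) = {c \<in> A \<rightarrow>\<^sub>E carrier R. finite {x \<in> A. c x \<noteq> \<zero>}}"
  "\<zero>\<^bsub>free_space R A\<^esub> = (\<lambda>x\<in>A. \<zero>)"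
  "b \<oplus>\<^bsub>free_space R A\<^esub> c = (\<lambda>x\<in>A. b x \<oplus> c x)"
  "k \<odot>\<^bsub>free_space R A\<^esub> c = (\<lambda>x\<in>A. k \<otimes> c x)"
  by (simp_all add: free_space_def func_space_def)

lemma free_space_vectorspace: "vectorspace R (free_space R A)"
proof -
  define C where "C = {c \<in> A \<rightarrow>\<^sub>E carrier R. finite {x \<in> A. c x \<noteq> \<zero>}}"
  have vs: "vectorspace R (func_space A)"
    using func_space_is_module[of A] field_axioms by (simp add: vectorspace_def)
  have "LinearCombinations.submodule R C (func_space A)"
    unfolding LinearCombinations.submodule_def
  proof (intro conjI allI impI)
    show "module R (func_space A)"
      by (rule func_space_is_module)
    show "C \<subseteq> carrier (func_space A)" "\<zero>\<^bsub>func_space A\<^esub> \<in> C"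
      by (auto simp: C_def func_space_def)
    show "v \<oplus>\<^bsub>func_space A\<^esub> w \<in> C" if "v \<in> C" "w \<in> C" for v w
    proof -
      have "{x \<in> A. (v \<oplus>\<^bsub>func_space A\<^esub> w) x \<noteq> \<zero>} \<subseteq> {x \<in> A. v x \<noteq> \<zero>} \<union> {x \<in> A. w x \<noteq> \<zero>}"
        by (auto simp: func_space_def)
      moreover have "finite ({x \<in> A. v x \<noteq> \<zero>} \<union> {x \<in> A. w x \<noteq> \<zero>})"
        using that unfolding C_def by simp
      ultimately have "finite {x \<in> A. (v \<oplus>\<^bsub>func_space A\<^esub> w) x \<noteq> \<zero>}"
        by (rule finite_subset)
      moreover have "v \<oplus>\<^bsub>func_space A\<^esub> w \<in> A \<rightarrow>\<^sub>E carrier R"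
        using that unfolding C_def by (auto simp: func_space_def PiE_mem)
      ultimately show ?thesis
        unfolding C_def by simp
    qed
    show "k \<odot>\<^bsub>func_space A\<^esub> v \<in> C" if "k \<in> carrier R" "v \<in> C" for k v
    proof -
      have "{x \<in> A. (k \<odot>\<^bsub>func_space A\<^esub> v) x \<noteq> \<zero>} \<subseteq> {x \<in> A. v x \<noteq> \<zero>}"
        using that by (auto simp: func_space_def)
      moreover have "finite {x \<in> A. v x \<noteq> \<zero>}"
        using that unfolding C_def by simp
      ultimately have "finite {x \<in> A. (k \<odot>\<^bsub>func_space A\<^esub> v) x \<noteq> \<zero>}"
        by (rule finite_subset)
      moreover have "k \<odot>\<^bsub>func_space A\<^esub> v \<in> A \<rightarrow>\<^sub>E carrier R"
        using that unfolding C_def by (auto simp: func_space_def PiE_mem)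
      ultimately show ?thesis
        unfolding C_def by simp
    qed
  qed
  then show ?thesis
    using vs vectorspace.subspace_is_vs[OF vs, of C]
    unfolding subspace_def free_space_def C_def by auto
qed

text \<open>Replaces the support of \<open>c\<close> as index set by any larger finite set, so that
  sums for different vectors can be compared.\<close>

lemma free_map_eq:
  assumes c: "c \<in> carrier (free_space R A)" and y: "y \<in> B"
    and F: "finite F" "F \<subseteq> A" "{x \<in> A. c x \<noteq> \<zero>} \<subseteq> F"
  shows "free_map R A B \<phi> c y = (\<Oplus>x\<in>{x \<in> F. \<phi> x = y}. c x)"
proof -
  have "(\<Oplus>x\<in>{x \<in> A. c x \<noteq> \<zero> \<and> \<phi> x = y}. c x) = (\<Oplus>x\<in>{x \<in> F. \<phi> x = y}. c x)"
    by (rule add.finprod_mono_neutral_cong_left) (use c F in \<open>auto simp: free_space_simps PiE_mem\<close>)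
  then show ?thesis
    using y by (simp add: free_map_def)
qed

lemma free_map_add:
  assumes c: "c \<in> carrier (free_space R A)" and d: "d \<in> carrier (free_space R A)"
  shows "free_map R A B \<phi> (c \<oplus>\<^bsub>free_space R A\<^esub> d) =
    free_map R A B \<phi> c \<oplus>\<^bsub>free_space R B\<^esub> free_map R A B \<phi> d"
proof
  fix y
  interpret V: vectorspace R "free_space R A" by (rule free_space_vectorspace)
  \<comment> \<open>A common index set for both vectors and their sum; the support of the sum may be
    smaller through cancellation.\<close>
  define F where "F = {x \<in> A. c x \<noteq> \<zero>} \<union> {x \<in> A. d x \<noteq> \<zero>}"
  have F: "finite F" "F \<subseteq> A" "{x \<in> A. c x \<noteq> \<zero>} \<subseteq> F" "{x \<in> A. d x \<noteq> \<zero>} \<subseteq> F"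
    using c d unfolding F_def by (auto simp: free_space_simps)
  have cd: "c \<oplus>\<^bsub>free_space R A\<^esub> d \<in> carrier (free_space R A)"
    using c d by simp
  have supp: "{x \<in> A. (c \<oplus>\<^bsub>free_space R A\<^esub> d) x \<noteq> \<zero>} \<subseteq> F"
    using c d unfolding F_def by (auto simp: free_space_simps)
  have mem: "c x \<in> carrier R" "d x \<in> carrier R" if "x \<in> F" for x
    using c d F(2) that by (auto simp: free_space_simps PiE_mem)
  show "free_map R A B \<phi> (c \<oplus>\<^bsub>free_space R A\<^esub> d) y =
    (free_map R A B \<phi> c \<oplus>\<^bsub>free_space R B\<^esub> free_map R A B \<phi> d) y"
  proof (cases "y \<in> B")
    case True
    have "free_map R A B \<phi> (c \<oplus>\<^bsub>free_space R A\<^esub> d) y =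
        (\<Oplus>x\<in>{x \<in> F. \<phi> x = y}. (c \<oplus>\<^bsub>free_space R A\<^esub> d) x)"
      by (rule free_map_eq[OF cd True F(1,2) supp])
    also have "\<dots> = (\<Oplus>x\<in>{x \<in> F. \<phi> x = y}. c x \<oplus> d x)"
      by (rule finsum_cong') (use mem F(2) in \<open>auto simp: free_space_simps\<close>)
    also have "\<dots> = free_map R A B \<phi> c y \<oplus> free_map R A B \<phi> d y"
      using mem F by (subst finsum_addf)
        (auto simp: free_map_eq[OF c True F(1,2,3)] free_map_eq[OF d True F(1,2,4)])
    finally show ?thesis
      using True by (simp add: free_space_simps)
  qed (simp add: free_map_def free_space_simps)
qed

text \<open>The diagonal idempotent that keeps the coordinates in \<open>P\<close>. It serves both
  for a whole fibre and for a single coordinate.\<close>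

definition coord_part :: "'s set \<Rightarrow> ('s \<Rightarrow> bool) \<Rightarrow> ('s \<Rightarrow> 'a) \<Rightarrow> ('s \<Rightarrow> 'a)" where
  "coord_part A P c = (\<lambda>x\<in>A. if P x then c x else \<zero>)"

lemma coord_part_linear: "linear_map R (free_space R A) (free_space R A) (coord_part A P)"
proof (rule linear_mapI[OF free_space_vectorspace free_space_vectorspace])
  show "coord_part A P c \<in> carrier (free_space R A)" if "c \<in> carrier (free_space R A)" for c
  proof -
    have "{x \<in> A. coord_part A P c x \<noteq> \<zero>} \<subseteq> {x \<in> A. c x \<noteq> \<zero>}"
      by (auto simp: coord_part_def)
    moreover have "finite {x \<in> A. c x \<noteq> \<zero>}"
      using that by (simp add: free_space_simps)
    ultimately have "finite {x \<in> A. coord_part A P c x \<noteq> \<zero>}"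
      by (rule finite_subset)
    moreover have "coord_part A P c \<in> A \<rightarrow>\<^sub>E carrier R"
      using that by (auto simp: free_space_simps coord_part_def PiE_mem)
    ultimately show ?thesis
      by (simp add: free_space_simps)
  qed
qed (auto simp: free_space_simps coord_part_def PiE_mem fun_eq_iff)

text \<open>By \<open>PQ\<close>, the coordinates mapped to a given \<open>y\<close> are all kept or
  all dropped, according to \<open>Q y\<close>.\<close>

lemma free_map_coord_part:
  assumes "\<And>x. x \<in> A \<Longrightarrow> \<phi> x \<in> B" and c: "c \<in> carrier (free_space R A)"
    and PQ: "\<And>x. x \<in> A \<Longrightarrow> P x \<longleftrightarrow> Q (\<phi> x)"
  shows "coord_part B Q (free_map R A B \<phi> c) = free_map R A B \<phi> (coord_part A P c)"
proof
  fix y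
  show "coord_part B Q (free_map R A B \<phi> c) y = free_map R A B \<phi> (coord_part A P c) y"
  proof (cases "y \<in> B")
    case True
    have "{x \<in> A. coord_part A P c x \<noteq> \<zero> \<and> \<phi> x = y} =
        (if Q y then {x \<in> A. c x \<noteq> \<zero> \<and> \<phi> x = y} else {})"
      using PQ by (auto simp: coord_part_def)
    moreover have "(\<Oplus>x\<in>{x \<in> A. c x \<noteq> \<zero> \<and> \<phi> x = y}. coord_part A P c x) =
        (\<Oplus>x\<in>{x \<in> A. c x \<noteq> \<zero> \<and> \<phi> x = y}. c x)" if "Q y"
      by (rule finsum_cong') (use that PQ c in \<open>auto simp: coord_part_def free_space_simps PiE_mem\<close>)
    ultimately show ?thesis
      using True by (simp add: coord_part_def free_map_def)
  qed (simp add: coord_part_def free_map_def)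
qed

text \<open>A finitely supported vector is the sum of its single-coordinate parts. Applied to a
  kernel: a linear map that kills all these parts kills the vector.\<close>

lemma free_space_mem_subspaceI:
  assumes W: "subspace R W (free_space R A)" and c: "c \<in> carrier (free_space R A)"
    and parts: "\<And>s. s \<in> A \<Longrightarrow> coord_part A (\<lambda>x. x = s) c \<in> W"
  shows "c \<in> W"
proof -
  have "coord_part A (\<lambda>x. x \<in> F) c \<in> W" if "finite F" "F \<subseteq> A" for F
    using that
  proof (induction F rule: finite_induct)
    case empty
    have "coord_part A (\<lambda>x. x \<in> {}) c = \<zero>\<^bsub>free_space R A\<^esub>"
      by (simp add: coord_part_def free_space_simps)
    then show ?case
      using subspaceD(2)[OF W] by simp
  next
    case (insert s F)
    have "coord_part A (\<lambda>x. x \<in> insert s F) c =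
        coord_part A (\<lambda>x. x = s) c \<oplus>\<^bsub>free_space R A\<^esub> coord_part A (\<lambda>x. x \<in> F) c"
    proof
      fix x
      have "x \<in> A \<Longrightarrow> c x \<in> carrier R"
        using c by (auto simp: free_space_simps PiE_mem)
      then show "coord_part A (\<lambda>x. x \<in> insert s F) c x =
          (coord_part A (\<lambda>x. x = s) c \<oplus>\<^bsub>free_space R A\<^esub> coord_part A (\<lambda>x. x \<in> F) c) x"
        using insert.hyps by (auto simp: coord_part_def free_space_simps)
    qed
    then show ?case
      using insert parts subspaceD(3)[OF W] by simp
  qed
  from this[of "{x \<in> A. c x \<noteq> \<zero>}"] have "coord_part A (\<lambda>x. x \<in> {x \<in> A. c x \<noteq> \<zero>}) c \<in> W"
    using c by (auto simp: free_space_simps)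
  moreover have "coord_part A (\<lambda>x. x \<in> {x \<in> A. c x \<noteq> \<zero>}) c = c"
    using c by (auto simp: coord_part_def free_space_simps fun_eq_iff PiE_def extensional_def)
  ultimately show ?thesis
    by simp
qed

text \<open>The vectors supported at \<open>s\<close> form a line, and \<open>c s\<close> being
  nonzero makes the part of \<open>c\<close> span it. This is the source of all rank-one statements
  at \<open>t\<close>.\<close>

lemma coord_part_singleton_multiple:
  assumes "b \<in> carrier (free_space R A)" "c \<in> carrier (free_space R A)" "c s \<noteq> \<zero>" "s \<in> A"
  obtains k where "k \<in> carrier R"
    "coord_part A (\<lambda>x. x = s) b = k \<odot>\<^bsub>free_space R A\<^esub> coord_part A (\<lambda>x. x = s) c"
proof
  have mem: "b s \<in> carrier R" "c s \<in> carrier R"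
    using assms by (auto simp: free_space_simps PiE_mem)
  have inv: "inv (c s) \<in> carrier R" "inv (c s) \<otimes> c s = \<one>"
    using mem assms field_Units by auto
  show "b s \<otimes> inv (c s) \<in> carrier R"
    using mem inv by simp
  show "coord_part A (\<lambda>x. x = s) b = (b s \<otimes> inv (c s)) \<odot>\<^bsub>free_space R A\<^esub> coord_part A (\<lambda>x. x = s) c"
    using mem inv by (auto simp: coord_part_def free_space_simps fun_eq_iff m_assoc)
qed

end

section \<open>Fibres over the elements at the terminal object\<close>

locale category_with_terminal = category +
  fixes t
  assumes terminal: "terminal_object X t"
begin

definition bang :: "'a \<Rightarrow> 'b" where
  "bang a = (THE f. f \<in> Mor X \<and> Src X f = a \<and> Tgt X f = t)"

lemma t_in: "t \<in> Obj X"
  using terminal unfolding terminal_object_def by simp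

lemma bang: "bang a \<in> Mor X" "Src X (bang a) = a" "Tgt X (bang a) = t" if "a \<in> Obj X"
  using theI'[of "\<lambda>f. f \<in> Mor X \<and> Src X f = a \<and> Tgt X f = t"] terminal that
  unfolding terminal_object_def bang_def by auto

lemma bang_unique: "bang (Src X f) = f" if "f \<in> Mor X" "Tgt X f = t"
  using bang[OF Src_in[OF that(1)]] Src_in[OF that(1)] terminal that unfolding terminal_object_def by blast

end

text \<open>An element of \<open>ob S a\<close> lies over \<open>s\<close> if the map to the
  terminal object sends it to \<open>s\<close>. Every morphism respects this, so restriction to the
  fibre is natural; at \<open>t\<close> the fibre over \<open>s\<close> is at most \<open>s\<close>
  itself.\<close>

lemma (in field) fibre_projection:
  assumes "category_with_terminal X t" and "set_rep X S"
  obtains e where "\<And>s. rep_hom R X (free_rep R X S) (free_rep R X S) (e s)"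
    "\<And>s c. c \<in> carrier (free_space R (ob S t)) \<Longrightarrow> e s t c = coord_part (ob S t) (\<lambda>x. x = s) c"
proof -
  interpret category_with_terminal X t by fact
  interpret S: set_rep X S by fact
  define e where "e s a = coord_part (ob S a) (\<lambda>x. ar S (bang a) x = s)" for s a
  have "ar S (bang (Src X f)) x = ar S (bang (Tgt X f)) (ar S f x)"
    if f: "f \<in> Mor X" and x: "x \<in> ob S (Src X f)" for f x
  proof -
    note b = bang[OF Tgt_in[OF f]]
    have "bang (Src X f) = Cmp X (bang (Tgt X f)) f"
      using bang_unique[of "Cmp X (bang (Tgt X f)) f"] b f Cmp_in Src_Cmp Tgt_Cmp by metis
    then show ?thesis
      using S.ar_Cmp[OF f b(1) _ x] b by simp
  qed
  then have "rep_hom R X (free_rep R X S) (free_rep R X S) (e s)" for s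
    unfolding rep_hom_def e_def free_rep_def
    using S.ar_in by (auto intro!: coord_part_linear free_map_coord_part)
  moreover have "e s t c = coord_part (ob S t) (\<lambda>x. x = s) c" for s c
  proof -
    \<comment> \<open>The identity is the only endomorphism of a terminal object, so at
      \<open>t\<close> lying over \<open>s\<close> means being \<open>s\<close>.\<close>
    have "bang t = Idn X t"
      using bang_unique[OF Idn_in] t_in by (simp add: Src_Idn Tgt_Idn)
    then show ?thesis
      using S.ar_Idn[OF t_in] unfolding e_def coord_part_def by (auto simp: fun_eq_iff)
  qed
  ultimately show thesis
    using that by blast
qed

section \<open>Endomorphisms of rank at most one at \<open>t\<close>\<close>

text \<open>The endomorphism is \<open>sect\<close> into the free representation, then the fibre
  idempotent for a suitable \<open>s\<close>, then \<open>retr\<close> back. At \<open>t\<close> it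
  factors through the line of the coordinate \<open>s\<close>.\<close>

lemma (in vect_rep) realizable_rank_one:
  assumes "terminal_object X t" and S: "set_rep X S"
    and P: "direct_summand K X (free_rep K X S) P"
    and U: "subrep K X R U"
    and iso: "rep_isomorphic K X (rep_restrict R U) (rep_restrict (free_rep K X S) P)"
    and p: "rep_hom K X R (rep_restrict R U) p"
    and v: "v \<in> carrier (ob R t)" "p t v \<noteq> \<zero>\<^bsub>ob R t\<^esub>"
  shows "\<exists>\<theta>. rep_hom K X R R \<theta> \<and> \<theta> t v \<noteq> \<zero>\<^bsub>ob R t\<^esub> \<and>
    (\<forall>x\<in>carrier (ob R t). \<exists>k\<in>carrier K. \<theta> t x = k \<odot>\<^bsub>ob R t\<^esub> \<theta> t v)"
proof -
  interpret X: category_with_terminal X t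
    by unfold_locales fact
  define FS where "FS = free_rep K X S"
  note t = X.t_in
  have FS_t: "ob FS t = free_space K (ob S t)"
    by (simp add: FS_def free_rep_def)
  obtain e where e: "\<And>s. rep_hom K X FS FS (e s)"
    and e_t: "\<And>s c. c \<in> carrier (free_space K (ob S t)) \<Longrightarrow> e s t c = coord_part (ob S t) (\<lambda>x. x = s) c"
    using fibre_projection[OF X.category_with_terminal_axioms S] unfolding FS_def by blast
  obtain W where W: "direct_sum2 K X FS P W"
    using P unfolding direct_summand_def FS_def by blast
  have subP: "subrep K X FS P"
    using W unfolding direct_sum2_def by simp
  have add: "ar FS f (x \<oplus>\<^bsub>ob FS (Src X f)\<^esub> y) = ar FS f x \<oplus>\<^bsub>ob FS (Tgt X f)\<^esub> ar FS f y"
    if "x \<in> carrier (ob FS (Src X f))" "y \<in> carrier (ob FS (Src X f))" for f x y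
    using that free_map_add unfolding FS_def free_rep_def by simp
  obtain q where q: "rep_hom K X FS (rep_restrict FS P) q"
    "\<And>a u w. \<lbrakk>a \<in> Obj X; u \<in> P a; w \<in> W a\<rbrakk> \<Longrightarrow> q a (u \<oplus>\<^bsub>ob FS a\<^esub> w) = u"
    using direct_sum2_projection[OF W add] by blast
  obtain \<eta> where \<eta>: "rep_hom K X (rep_restrict R U) (rep_restrict FS P) \<eta>"
    and bij: "\<And>a. a \<in> Obj X \<Longrightarrow> bij_betw (\<eta> a) (carrier (ob (rep_restrict R U) a)) (carrier (ob (rep_restrict FS P) a))"
    using iso unfolding rep_isomorphic_def rep_hom_def FS_def by blast
  have closed: "ar (rep_restrict R U) f \<in> carrier (ob (rep_restrict R U) (Src X f)) \<rightarrow> carrier (ob (rep_restrict R U) (Tgt X f))"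
    if "f \<in> Mor X" for f
    using U that unfolding subrep_def rep_restrict_def by simp
  define \<zeta> where "\<zeta> a = inv_into (carrier (ob (rep_restrict R U) a)) (\<eta> a)" for a
  have \<zeta>: "rep_hom K X (rep_restrict FS P) (rep_restrict R U) \<zeta>"
    unfolding \<zeta>_def by (rule rep_hom_inverse[OF \<eta> bij closed])
  \<comment> \<open>The inclusion of \<open>U\<close> into \<open>R\<close> is the identity on
    values and leaves no trace in the term; likewise the inclusion of \<open>P\<close> in
    \<open>sect\<close>.\<close>
  define retr where "retr a x = \<zeta> a (q a x)" for a x
  have retr: "rep_hom K X FS R retr"
    unfolding retr_def
    using rep_hom_comp[OF rep_hom_comp[OF q(1) \<zeta>] rep_hom_inclusion[OF U]] .
  define sect where "sect a x = \<eta> a (p a x)" for a x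
  have sect: "rep_hom K X R FS sect"
    unfolding sect_def
    using rep_hom_comp[OF rep_hom_comp[OF p \<eta>] rep_hom_inclusion[OF subP]] .
  define \<theta> where "\<theta> s a x = retr a (e s a (sect a x))" for s a x
  have \<theta>: "rep_hom K X R R (\<theta> s)" for s
    unfolding \<theta>_def using rep_hom_comp[OF rep_hom_comp[OF sect e[of s]] retr] .
  note retr_lin = linear_mapD[OF rep_homD(1)[OF retr t], unfolded FS_t]
  have sect_in: "sect t x \<in> carrier (free_space K (ob S t))" if "x \<in> carrier (ob R t)" for x
    using linear_mapD(3)[OF rep_homD(1)[OF sect t] that] by (simp add: FS_t)
  have pv: "p t v \<in> carrier (ob (rep_restrict R U) t)"
    by (rule linear_mapD(3)[OF rep_homD(1)[OF p t] v(1)])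
  \<comment> \<open>\<open>sect t v\<close> already lies in \<open>P\<close>, so \<open>q\<close>
    fixes it, seen by adding zero from \<open>W\<close>; then \<open>\<zeta>\<close> undoes
    \<open>\<eta>\<close>.\<close>
  have round: "retr t (sect t v) = p t v"
  proof -
    interpret V: vectorspace K "ob FS t"
      unfolding FS_t by (rule free_space_vectorspace)
    have "sect t v \<in> P t"
      using linear_mapD(3)[OF rep_homD(1)[OF \<eta> t] pv] unfolding sect_def rep_restrict_def by simp
    moreover have "subspace K (P t) (ob FS t)" "subspace K (W t) (ob FS t)"
      using W t unfolding direct_sum2_def subrep_def by auto
    ultimately have "q t (sect t v) = sect t v"
      using q(2)[OF t, of "sect t v" "\<zero>\<^bsub>ob FS t\<^esub>"] subspaceD(1,2) by fastforce
    then show ?thesis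
      using pv bij[OF t] unfolding retr_def \<zeta>_def sect_def
      by (simp add: bij_betw_inv_into_left)
  qed
  \<comment> \<open>Otherwise \<open>retr t\<close> kills every coordinate part of
    \<open>sect t v\<close>, hence \<open>sect t v\<close> itself, although its value there is the
    nonzero \<open>p t v\<close>.\<close>
  have "\<exists>s\<in>ob S t. \<theta> s t v \<noteq> \<zero>\<^bsub>ob R t\<^esub>"
  proof (rule ccontr)
    assume "\<not> ?thesis"
    then have zero: "retr t (coord_part (ob S t) (\<lambda>x. x = s) (sect t v)) = \<zero>\<^bsub>ob R t\<^esub>" if "s \<in> ob S t" for s
      using that e_t[OF sect_in[OF v(1)]] unfolding \<theta>_def by auto
    have "subspace K {c \<in> carrier (ob FS t). retr t c = \<zero>\<^bsub>ob R t\<^esub>} (ob FS t)"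
      by (rule linear_map.subspace_kernel[OF rep_homD(1)[OF retr t]])
    then have "sect t v \<in> {c \<in> carrier (ob FS t). retr t c = \<zero>\<^bsub>ob R t\<^esub>}"
      unfolding FS_t
    proof (rule free_space_mem_subspaceI[OF _ sect_in[OF v(1)]])
      fix s assume "s \<in> ob S t"
      from zero[OF this] linear_mapD(3)[OF coord_part_linear sect_in[OF v(1)]]
      show "coord_part (ob S t) (\<lambda>x. x = s) (sect t v)
          \<in> {c \<in> carrier (free_space K (ob S t)). retr t c = \<zero>\<^bsub>ob R t\<^esub>}"
        by (intro CollectI conjI)
    qed
    then show False
      using round v by simp
  qed
  then obtain s where s: "s \<in> ob S t" "\<theta> s t v \<noteq> \<zero>\<^bsub>ob R t\<^esub>"
    by blast
  have nz: "sect t v s \<noteq> \<zero>\<^bsub>K\<^esub>"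
  proof
    assume "sect t v s = \<zero>\<^bsub>K\<^esub>"
    then have "e s t (sect t v) = \<zero>\<^bsub>free_space K (ob S t)\<^esub>"
      unfolding e_t[OF sect_in[OF v(1)]] by (auto simp: coord_part_def free_space_simps fun_eq_iff)
    then show False
      using s(2) retr_lin(6) unfolding \<theta>_def by simp
  qed
  \<comment> \<open>By \<open>nz\<close> the \<open>s\<close>-part of \<open>sect t v\<close> spans
    the line of that coordinate; linearity of \<open>retr\<close> carries the factor
    \<open>k\<close> over to \<open>R\<close>.\<close>
  have "\<exists>k\<in>carrier K. \<theta> s t x = k \<odot>\<^bsub>ob R t\<^esub> \<theta> s t v" if x: "x \<in> carrier (ob R t)" for x
  proof -
    obtain k where k: "k \<in> carrier K"
      "e s t (sect t x) = k \<odot>\<^bsub>free_space K (ob S t)\<^esub> e s t (sect t v)"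
      using coord_part_singleton_multiple[OF sect_in[OF x] sect_in[OF v(1)] nz s(1)]
        e_t[OF sect_in[OF x]] e_t[OF sect_in[OF v(1)]] by metis
    moreover have "e s t (sect t v) \<in> carrier (free_space K (ob S t))"
      using linear_mapD(3)[OF rep_homD(1)[OF e t]] sect_in[OF v(1)] by (simp add: FS_t)
    ultimately show ?thesis
      using retr_lin(5) unfolding \<theta>_def by auto
  qed
  then show ?thesis
    using \<theta> s(2) by blast
qed

section \<open>The dimension at the terminal object\<close>

theorem lemma6p5:
  fixes F :: "('k, 'r) ring_scheme"
    and X :: "('o, 'm) cat"
    and t :: 'o
    and R :: "('o, 'm, 'k, 'v) vect_rep"
  assumes "field F"
    and "finite_category X"
    and "terminal_object X t"
    and "fin_dim_vect_rep F X R"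
    and "indecomposable F X R"
    and "additively_Set_realizable TYPE('s) F X R"
  shows "vectorspace.dim F (ob R t) \<le> 1"
proof -
  interpret R: fin_dim_vect_rep F X R by fact
  have t: "t \<in> Obj X"
    using assms(3) unfolding terminal_object_def by simp
  interpret V: vectorspace F "ob R t" by (rule R.ob_vectorspace[OF t])
  obtain n U where dec: "direct_sum_decomp F X R n U"
    and real: "\<And>i. i < n \<Longrightarrow> \<exists>(S :: ('o, 'm, 's) set_rep) P.
        set_rep X S \<and> direct_summand F X (free_rep F X S) P \<and>
        rep_isomorphic F X (rep_restrict R (U i)) (rep_restrict (free_rep F X S) P)"
    using assms(6) unfolding additively_Set_realizable_def by blast
  obtain p where p: "\<And>i. i < n \<Longrightarrow> rep_hom F X R (rep_restrict R (U i)) (p i)"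
    and sep: "\<And>a v. \<lbrakk>a \<in> Obj X; v \<in> carrier (ob R a); v \<noteq> \<zero>\<^bsub>ob R a\<^esub>\<rbrakk> \<Longrightarrow> \<exists>i<n. p i a v \<noteq> \<zero>\<^bsub>ob R a\<^esub>"
    using R.direct_sum_decomp_projection[OF dec] by blast
  \<comment> \<open>Taking all endomorphisms of \<open>R\<close>, evaluated at \<open>t\<close>,
    gives closure under composition, and the map found in \<open>E\<close> extends to the whole
    representation, where indecomposability applies.\<close>
  define E where "E = {\<theta> t | \<theta>. rep_hom F X R R \<theta>}"
  have E_sep: "\<exists>f\<in>E. f v \<noteq> \<zero>\<^bsub>ob R t\<^esub> \<and>
      (\<forall>x\<in>carrier (ob R t). \<exists>k\<in>carrier F. f x = k \<odot>\<^bsub>ob R t\<^esub> f v)"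
    if v: "v \<in> carrier (ob R t)" "v \<noteq> \<zero>\<^bsub>ob R t\<^esub>" for v
  proof -
    obtain i where i: "i < n" "p i t v \<noteq> \<zero>\<^bsub>ob R t\<^esub>"
      using sep[OF t v] by blast
    obtain S :: "('o, 'm, 's) set_rep" and P where "set_rep X S"
      "direct_summand F X (free_rep F X S) P"
      "rep_isomorphic F X (rep_restrict R (U i)) (rep_restrict (free_rep F X S) P)"
      using real[OF i(1)] by blast
    moreover have "subrep F X R (U i)"
      using dec i(1) unfolding direct_sum_decomp_def by blast
    ultimately show ?thesis
      using R.realizable_rank_one[OF assms(3) _ _ _ _ p[OF i(1)] v(1) i(2)]
      unfolding E_def by blast
  qed
  have E_lin: "linear_map F (ob R t) (ob R t) f" if "f \<in> E" for f
    using that rep_homD(1)[OF _ t] unfolding E_def by blast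
  have E_comp: "(\<lambda>x. f (g x)) \<in> E" if f: "f \<in> E" and g: "g \<in> E" for f g
  proof -
    obtain \<theta> where \<theta>: "f = \<theta> t" "rep_hom F X R R \<theta>"
      using f unfolding E_def by auto
    obtain \<psi> where \<psi>: "g = \<psi> t" "rep_hom F X R R \<psi>"
      using g unfolding E_def by auto
    show ?thesis
      unfolding E_def \<theta>(1) \<psi>(1)
      using R.rep_hom_comp[OF \<psi>(2) \<theta>(2)]
      by (intro CollectI exI[of _ "\<lambda>a x. \<theta> a (\<psi> a x)"] conjI refl)
  qed
  show ?thesis
  \<comment> \<open>Indecomposability excludes only that \<open>R\<close> vanishes at every object,
    so the space at \<open>t\<close> may still be zero.\<close>
  proof (cases "carrier (ob R t) = {\<zero>\<^bsub>ob R t\<^esub>}")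
    case True
    then show ?thesis
      using V.dim_le1I[of "\<zero>\<^bsub>ob R t\<^esub>"] V.span_self V.span_is_subset2[of "{\<zero>\<^bsub>ob R t\<^esub>}"] by auto
  next
    case False
    obtain f u where fu: "f \<in> E" "u \<in> carrier (ob R t)" "f u \<noteq> \<zero>\<^bsub>ob R t\<^esub>"
      "\<forall>x\<in>carrier (ob R t). \<exists>a\<in>carrier F. f x = a \<odot>\<^bsub>ob R t\<^esub> u"
      by (rule V.rank_one_eigenvector[where E = E, OF R.fin_dim[OF t] False])
        ((erule E_lin | (rule E_comp; assumption) | (erule E_sep, assumption) | blast)+)
    then show ?thesis
      using R.dim_le_1_if_rank_one_eigenvector[OF assms(5) _ t] unfolding E_def by blast
  qed
qed

end
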